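(* Let $A\in\mathcal{M}_n$ be accretive-dissipative and let $t\in(0,1)$. Then \[ \omega(A^t)\ \geq\ \omega^t(A), \] where $\omega^t(A)$ means $(\omega(A))^t$.
   Context: $\mathcal{M}_n$ is the algebra of $n\times n$ complex matrices, and $\omega(A)=\max\{|\langle Ax,x\rangle| : x\in\mathbb{C}^n,\ \|x\|=1\}$ is the numerical radius. The numerical range is $W(A)=\{\langle Ax,x\rangle : x\in\mathbb{C}^n,\ \|x\|=1\}$. A matrix is positive definite, written $A>O$, if $W(A)\subset(0,\infty)$. Write $\Re(A)=\frac{A+A^*}{2}$ and $\Im(A)=\frac{A-A^*}{2i}$. $A$ is accretive-dissipative if both $\Re(A)>O$ and $\Im(A)>O$. For $A$ with $W(A)\cap(-\infty,0]=\varnothing$ and $t\in(0,1)$, $A^t$ is the principal fractional power \[ A^t=\frac{1}{2\pi i}\int_{\Omega_A} z^t(zI-A)^{-1}\,dz, \] where $z^t$ is the principal power and $\Omega_A$ is a contour in the resolvent set of $A$ that winds once about each eigenvalue of $A$ and avoids $(-\infty,0]$. Equivalently, $A^t=\frac{\sin(t\pi)}{\pi}\int_0^\infty s^{t-1}A(sI+A)^{-1}\,ds$. *)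

theory Defs
  imports "HOL-Complex_Analysis.Winding_Numbers"
begin

(* The library's \<bullet> on complex ^ 'n is the real inner product, i.e. the real part of this one;
   the library norm on complex ^ 'n is the norm induced by it. *)
definition cinner :: "complex ^ 'n \<Rightarrow> complex ^ 'n \<Rightarrow> complex" where
  "cinner x y = (\<Sum>i\<in>UNIV. x $ i * cnj (y $ i))"

definition adjoint_mat :: "complex ^ 'n ^ 'n \<Rightarrow> complex ^ 'n ^ 'n" where
  "adjoint_mat A = (\<chi> i j. cnj (A $ j $ i))"

definition Re_mat :: "complex ^ 'n ^ 'n \<Rightarrow> complex ^ 'n ^ 'n" where
  "Re_mat A = (\<chi> i j. (A $ i $ j + adjoint_mat A $ i $ j) / 2)"

definition Im_mat :: "complex ^ 'n ^ 'n \<Rightarrow> complex ^ 'n ^ 'n" where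
  "Im_mat A = (\<chi> i j. (A $ i $ j - adjoint_mat A $ i $ j) / (2 * \<i>))"

definition numerical_range :: "complex ^ 'n ^ 'n \<Rightarrow> complex set" where
  "numerical_range A = {cinner (A *v x) x | x. norm x = 1}"

(* The supremum is a maximum, see numerical_radius_attained. *)
definition numerical_radius :: "complex ^ 'n ^ 'n \<Rightarrow> real" where
  "numerical_radius A = (SUP z\<in>numerical_range A. cmod z)"

definition positive_definite :: "complex ^ 'n ^ 'n \<Rightarrow> bool" where
  "positive_definite A \<longleftrightarrow> numerical_range A \<subseteq> complex_of_real ` {0<..}"

definition accretive_dissipative :: "complex ^ 'n ^ 'n \<Rightarrow> bool" where
  "accretive_dissipative A \<longleftrightarrow> positive_definite (Re_mat A) \<and> positive_definite (Im_mat A)"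

definition eigenvalue_mat :: "complex ^ 'n ^ 'n \<Rightarrow> complex \<Rightarrow> bool" where
  "eigenvalue_mat A \<mu> \<longleftrightarrow> (\<exists>v. v \<noteq> 0 \<and> A *v v = \<mu> *s v)"

definition resolvent_set :: "complex ^ 'n ^ 'n \<Rightarrow> complex set" where
  "resolvent_set A = {z. invertible (mat z - A)}"

definition power_contour :: "complex ^ 'n ^ 'n \<Rightarrow> (real \<Rightarrow> complex) \<Rightarrow> bool" where
  "power_contour A \<gamma> \<longleftrightarrow>
     valid_path \<gamma> \<and> pathfinish \<gamma> = pathstart \<gamma> \<and>
     path_image \<gamma> \<subseteq> resolvent_set A \<and> path_image \<gamma> \<inter> \<real>\<^sub>\<le>\<^sub>0 = {} \<and>
     (\<forall>\<mu>. eigenvalue_mat A \<mu> \<longrightarrow> winding_number \<gamma> \<mu> = 1)"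

(* The matrix-valued integral is taken entrywise.  By the residue theorem on the slit plane its
   value does not depend on which admissible contour is chosen.  The definition is meaningful only
   if an admissible contour exists; see power_contour_exists. *)
definition mat_powr :: "complex ^ 'n ^ 'n \<Rightarrow> real \<Rightarrow> complex ^ 'n ^ 'n" where
  "mat_powr A t =
     (let \<gamma> = (SOME \<gamma>. power_contour A \<gamma>) in
       (\<chi> i j. 1 / (2 * of_real pi * \<i>) *
          contour_integral \<gamma> (\<lambda>z. z powr complex_of_real t * matrix_inv (mat z - A) $ i $ j)))"

lemma numerical_range_compact: "compact (numerical_range (A :: complex ^ 'n ^ 'n))"
proof -
  have "numerical_range A = (\<lambda>x. cinner (A *v x) x) ` sphere 0 1"
    unfolding numerical_range_def by (auto simp: image_iff)
  moreover have "continuous_on (sphere 0 1) (\<lambda>x. cinner (A *v x) x)"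
    unfolding cinner_def matrix_vector_mult_def by (auto intro!: continuous_intros)
  ultimately show ?thesis
    by (simp add: compact_continuous_image)
qed

lemma numerical_range_nonempty: "numerical_range (A :: complex ^ 'n ^ 'n) \<noteq> {}"
  unfolding numerical_range_def using vector_choose_size[of 1] by auto

lemma numerical_radius_attained:
  fixes A :: "complex ^ 'n ^ 'n"
  shows "\<exists>z\<in>numerical_range A. cmod z = numerical_radius A \<and> (\<forall>w\<in>numerical_range A. cmod w \<le> cmod z)"
proof -
  have "\<exists>z\<in>numerical_range A. \<forall>w\<in>numerical_range A. cmod w \<le> cmod z"
    by (intro continuous_attains_sup numerical_range_compact numerical_range_nonempty
        continuous_intros)
  then obtain z where z: "z \<in> numerical_range A" "\<forall>w\<in>numerical_range A. cmod w \<le> cmod z" by auto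
  then have "numerical_radius A = cmod z"
    unfolding numerical_radius_def by (intro cSup_eq_maximum) auto
  then show ?thesis using z by auto
qed

lemma cinner_Re_mat: "cinner (Re_mat A *v x) x = complex_of_real (Re (cinner (A *v x) x))"
proof -
  have 1: "cinner (A *v x) x = (\<Sum>i\<in>UNIV. \<Sum>j\<in>UNIV. A $ i $ j * x $ j * cnj (x $ i))"
    by (simp add: cinner_def matrix_vector_mult_def sum_distrib_right)
  have "cnj (cinner (A *v x) x) = (\<Sum>i\<in>UNIV. \<Sum>j\<in>UNIV. cnj (A $ i $ j) * cnj (x $ j) * x $ i)"
    by (simp add: 1)
  also have "\<dots> = (\<Sum>i\<in>UNIV. \<Sum>j\<in>UNIV. cnj (A $ j $ i) * x $ j * cnj (x $ i))"
    by (subst sum.swap) (simp add: mult_ac)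
  finally have 2: "cnj (cinner (A *v x) x) = \<dots>" .
  have "cinner (Re_mat A *v x) x =
      (\<Sum>i\<in>UNIV. \<Sum>j\<in>UNIV. (A $ i $ j * x $ j * cnj (x $ i) + cnj (A $ j $ i) * x $ j * cnj (x $ i)) / 2)"
    by (simp add: cinner_def matrix_vector_mult_def Re_mat_def adjoint_mat_def sum_distrib_right
        distrib_right add_divide_distrib)
  also have "\<dots> = (cinner (A *v x) x + cnj (cinner (A *v x) x)) / 2"
    unfolding 2 unfolding 1 by (simp add: sum.distrib sum_divide_distrib add_divide_distrib)
  finally have "cinner (Re_mat A *v x) x = (cinner (A *v x) x + cnj (cinner (A *v x) x)) / 2" .
  then show ?thesis by (simp add: complex_add_cnj)
qed

lemma eigenvalue_in_numerical_range:
  assumes "eigenvalue_mat A \<mu>" shows "\<mu> \<in> numerical_range A"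
proof -
  obtain v where v: "v \<noteq> 0" "A *v v = \<mu> *s v" using assms by (auto simp: eigenvalue_mat_def)
  define c where "c = complex_of_real (1 / norm v)"
  define u where "u = c *s v"
  have u_scale: "u = (1 / norm v) *\<^sub>R v"
    by (simp add: u_def c_def vec_eq_iff scaleR_conv_of_real[where 'a = complex])
  have nu: "norm u = 1" using v(1) by (simp add: u_scale)
  have "A *v u = \<mu> *s u"
    using v(2) by (simp add: u_def vector_scalar_commute vector_smult_assoc mult.commute)
  moreover have "cinner (\<mu> *s u) u = \<mu> * complex_of_real ((norm u)\<^sup>2)"
  proof -
    have "(norm u)\<^sup>2 = (\<Sum>i\<in>UNIV. (cmod (u $ i))\<^sup>2)"
      by (simp add: norm_vec_def L2_set_def sum_nonneg)
    then have "complex_of_real ((norm u)\<^sup>2) = (\<Sum>i\<in>UNIV. u $ i * cnj (u $ i))"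
      by (simp only: of_real_sum complex_norm_square)
    then show ?thesis
      by (simp only: cinner_def sum_distrib_left vector_smult_component mult.assoc)
  qed
  ultimately show ?thesis using nu by (metis (mono_tags, lifting) mem_Collect_eq mult.right_neutral numerical_range_def of_real_1 power_one)
qed

lemma not_eigenvalue_resolvent:
  assumes "\<not> eigenvalue_mat A z" shows "z \<in> resolvent_set A"
proof -
  have "x = 0" if "(mat z - A) *v x = 0" for x
  proof -
    have "mat z *v x = z *s x"
      by (simp add: vec_eq_iff matrix_vector_mult_def mat_def if_distrib[of "\<lambda>y. y * _"] cong: if_cong)
    then show ?thesis using that assms
      by (auto simp: eigenvalue_mat_def matrix_vector_mult_diff_rdistrib)
  qed
  then show ?thesis
    unfolding resolvent_set_def by (auto simp: invertible_left_inverse matrix_left_invertible_ker)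
qed

lemma power_contour_exists:
  fixes A :: "complex ^ 'n ^ 'n"
  assumes "accretive_dissipative A"
  shows "\<exists>\<gamma>. power_contour A \<gamma>"
proof -
  let ?W = "numerical_range A"
  have pos: "Re z > 0" if z: "z \<in> ?W" for z
  proof -
    obtain x where x: "z = cinner (A *v x) x" "norm x = 1"
      using z by (auto simp: numerical_range_def)
    have "cinner (Re_mat A *v x) x \<in> numerical_range (Re_mat A)"
      using x by (auto simp: numerical_range_def)
    then show ?thesis
      using assms x by (auto simp: accretive_dissipative_def positive_definite_def cinner_Re_mat)
  qed
  have "continuous_on ?W (\<lambda>z. (cmod z)\<^sup>2 / Re z)"
  proof (rule continuous_on_divide)
    show "\<forall>z\<in>?W. Re z \<noteq> 0" using pos by force
  qed (intro continuous_intros)+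
  then obtain B where B: "\<And>z. z \<in> ?W \<Longrightarrow> (cmod z)\<^sup>2 / Re z \<le> B"
    using continuous_attains_sup[OF numerical_range_compact numerical_range_nonempty] by blast
  define R where "R = max B 1"
  have R: "R > 0" by (simp add: R_def)
  have inside: "cmod (z - of_real R) < R" if "z \<in> ?W" for z
  proof -
    have "(cmod z)\<^sup>2 / Re z \<le> R" using B[OF that] by (simp add: R_def)
    then have "(cmod z)\<^sup>2 \<le> R * Re z" using pos[OF that] by (simp add: field_simps)
    also have "\<dots> < 2 * R * Re z" using pos[OF that] R by simp
    finally have "(cmod z)\<^sup>2 < 2 * R * Re z" .
    moreover have "(cmod (z - of_real R))\<^sup>2 = (cmod z)\<^sup>2 - 2 * R * Re z + R\<^sup>2"
      unfolding cmod_power2 by (simp add: power2_eq_square algebra_simps)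
    ultimately have "(cmod (z - of_real R))\<^sup>2 < R\<^sup>2" by linarith
    then show ?thesis using R by (rule power2_less_imp_less[OF _ less_imp_le])
  qed
  have "continuous_on ?W (\<lambda>z. cmod (z - of_real R))"
    by (intro continuous_intros)
  from continuous_attains_sup[OF numerical_range_compact numerical_range_nonempty this]
  obtain z0 where z0: "z0 \<in> ?W" "\<And>z. z \<in> ?W \<Longrightarrow> cmod (z - of_real R) \<le> cmod (z0 - of_real R)"
    by auto
  obtain r where r: "cmod (z0 - of_real R) < r" "r < R"
    using dense[OF inside[OF z0(1)]] by auto
  have r0: "r > 0" using r(1) by (rule le_less_trans[OF norm_ge_zero])
  have less: "cmod (z - of_real R) < r" if "eigenvalue_mat A z" for z
    using z0(2)[OF eigenvalue_in_numerical_range[OF that]] r by simp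
  have "power_contour A (circlepath (of_real R) r)"
    unfolding power_contour_def
  proof (intro conjI allI impI)
    show "path_image (circlepath (of_real R) r) \<subseteq> resolvent_set A"
    proof
      fix z assume "z \<in> path_image (circlepath (of_real R) r)"
      then have "cmod (z - of_real R) = r"
        using r0 by (simp add: dist_norm norm_minus_commute)
      then show "z \<in> resolvent_set A"
        using less[of z] by (intro not_eigenvalue_resolvent) auto
    qed
    have "z \<notin> \<real>\<^sub>\<le>\<^sub>0" if "dist (complex_of_real R) z = r" for z
      using that r(2) abs_Re_le_cmod[of "of_real R - z"]
      by (simp add: dist_norm complex_nonpos_Reals_iff)
    then show "path_image (circlepath (of_real R) r) \<inter> \<real>\<^sub>\<le>\<^sub>0 = {}"
      using r0 by (auto simp del: dist_commute)
    show "winding_number (circlepath (of_real R) r) z = 1" if "eigenvalue_mat A z" for z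
      using less[OF that] by (intro winding_number_circlepath) auto
  qed auto
  then show ?thesis by (rule exI[where x = "circlepath (of_real R) r"])
qed

end

theory Submission
  imports Defs "HOL-Complex_Analysis.Complex_Analysis"
begin

text \<open>
  Choose a unit vector \<open>x\<close> with \<open>\<langle>Ax, x\<rangle> = \<omega> e\<^bsup>i\<theta>\<^esup>\<close>, where \<open>\<omega>\<close> is the numerical radius. Since the
  numerical range lies in the open first quadrant, \<open>0 < \<theta> < \<pi>/2\<close>, so \<open>B = e\<^bsup>-i\<theta>\<^esup>A\<close> is still
  accretive, and \<open>x\<close> is an eigenvector of its real part for the largest eigenvalue \<open>\<omega>\<close>. Completing
  the square then gives \<open>Re \<langle>(s + B)\<^bsup>-1\<^esup>x, x\<rangle> \<le> 1/(s + \<omega>)\<close>, that is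
  \<open>Re \<langle>B(s + B)\<^bsup>-1\<^esup>x, x\<rangle> \<ge> \<omega>/(s + \<omega>)\<close>, for all \<open>s > 0\<close>. As \<open>z\<^bsup>t\<^esup>\<close> is a positive multiple of
  \<open>\<integral> s\<^bsup>t-1\<^esup> z/(s + z) ds\<close>, this yields \<open>Re \<langle>B\<^bsup>t\<^esup>x, x\<rangle> \<ge> \<omega>\<^bsup>t\<^esup>\<close>, while \<open>B\<^bsup>t\<^esup> = e\<^bsup>-i\<theta>t\<^esup>A\<^bsup>t\<^esup>\<close>.

  With \<open>s = e\<^sup>u\<close>, the integral truncated to \<open>-n \<le> u \<le> n\<close> and divided by its value at \<open>z = 1\<close> converges to
  \<open>z\<^bsup>t\<^esup>\<close> uniformly on compact subsets of the slit plane, which suffices to pass to the limit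
  under the Cauchy integral; neither convergence nor the value of the full integral is needed.
\<close>

unbundle no fps_syntax

section \<open>A resolvent bound in a real inner product space\<close>

text \<open>Completing the square: the form of s + \<open>T\<close> is nonnegative at
  \<open>z = y - c *\<^sub>R x\<close> with c = 1/(s + \<omega>). As \<open>T\<close> need not be
  symmetric, \<open>x\<close> need not be an eigenvector of \<open>T\<close>, but the cross terms of
  the form only involve the symmetric part; hence an inequality instead of an exact value.\<close>

lemma inverse_form_le:
  fixes T :: "'a::real_inner \<Rightarrow> 'a"
  assumes T: "linear T" and nonneg: "\<And>v. inner (T v) v \<ge> 0"
    and le: "\<And>v. inner (T v) v \<le> \<omega> * (norm v)\<^sup>2"
    and x: "norm x = 1" "inner (T x) x = \<omega>"
    and s: "s > 0" and y: "s *\<^sub>R y + T y = x"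
  shows "inner y x \<le> 1 / (s + \<omega>)"
proof -
  have \<omega>: "\<omega> \<ge> 0" using nonneg[of x] x by simp
  have xx: "inner x x = 1" using x(1) by (simp add: norm_eq_sqrt_inner)
  \<comment> \<open>\<open>x\<close> maximises the quadratic form of \<open>T\<close>, hence is an eigenvector of its symmetric part\<close>
  have sym: "inner (T x) v + inner (T v) x = 2 * \<omega> * inner x v" for v
  proof -
    define b where "b = 2 * \<omega> * inner x v - (inner (T x) v + inner (T v) x)"
    define a where "a = \<omega> * inner v v - inner (T v) v"
    have a: "a \<ge> 0" using le[of v] by (simp add: a_def power2_norm_eq_inner)
    \<comment> \<open>The bound \<open>le\<close> at \<open>x + e *\<^sub>R v\<close>, compared with
      equality at \<open>x\<close>: a quadratic in \<open>e\<close> without constant term that is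
      nowhere negative, so its linear coefficient must vanish.\<close>
    have pos: "e * b + e\<^sup>2 * a \<ge> 0" for e
    proof -
      have "inner (T (x + e *\<^sub>R v)) (x + e *\<^sub>R v) \<le> \<omega> * inner (x + e *\<^sub>R v) (x + e *\<^sub>R v)"
        using le[of "x + e *\<^sub>R v"] by (simp add: power2_norm_eq_inner)
      then show ?thesis
        using T xx x(2) unfolding a_def b_def
        by (simp add: linear_add linear_scale inner_add_left inner_add_right inner_commute
            power2_eq_square algebra_simps)
    qed
    \<comment> \<open>This value of \<open>e\<close> makes the quadratic negative unless
      \<open>b = 0\<close>; the denominator \<open>a + 1\<close> also covers
      \<open>a = 0\<close>.\<close>
    have "- b / (a + 1) * b + (- b / (a + 1))\<^sup>2 * a = - ((b / (a + 1))\<^sup>2)"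
      using a by (simp add: power2_eq_square divide_simps) (simp add: algebra_simps)
    with pos[of "- b / (a + 1)"] have "(b / (a + 1))\<^sup>2 \<le> 0" by linarith
    then have "b / (a + 1) = 0" by simp
    then have "b = 0" using a by simp
    then show ?thesis by (simp add: b_def)
  qed
  define q where "q = inner y x"
  \<comment> \<open>\<open>c *\<^sub>R x\<close> is what \<open>y\<close> would be if
    \<open>x\<close> were an eigenvector of \<open>T\<close> itself, with eigenvalue
    \<omega>.\<close>
  define c where "c = 1 / (s + \<omega>)"
  have c: "c * (s + \<omega>) = 1" using s \<omega> by (simp add: c_def)
  define z where "z = y - c *\<^sub>R x"
  have q: "s * inner y y + inner (T y) y = q"
    unfolding q_def y[symmetric] by (simp add: inner_add_right inner_commute)
  have "0 \<le> s * inner z z + inner (T z) z"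
    using s nonneg[of z] by simp
  also have "\<dots> = (s * inner y y + inner (T y) y) - c * (2 * s * inner x y + (inner (T x) y + inner (T y) x))
      + c * (c * (s * inner x x + inner (T x) x))"
    using T unfolding z_def
    by (simp add: linear_diff linear_scale inner_diff_left inner_diff_right inner_commute algebra_simps)
  also have "\<dots> = q - 2 * (c * (s + \<omega>)) * q + c * (c * (s + \<omega>))"
    unfolding q sym xx x(2) by (simp add: q_def inner_commute algebra_simps)
  also have "\<dots> = c - q" by (simp add: c)
  finally show ?thesis by (simp add: q_def c_def)
qed

subsection \<open>The inner product and the numerical range\<close>

lemma Re_cinner: "Re (cinner x y) = inner x y"
  by (simp add: cinner_def inner_vec_def inner_complex_def)

lemma cinner_self: "cinner x x = complex_of_real ((norm x)\<^sup>2)"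
proof -
  have "(norm x)\<^sup>2 = (\<Sum>i\<in>UNIV. (cmod (x $ i))\<^sup>2)"
    by (simp add: norm_vec_def L2_set_def sum_nonneg)
  then have "complex_of_real ((norm x)\<^sup>2) = (\<Sum>i\<in>UNIV. x $ i * cnj (x $ i))"
    by (simp only: of_real_sum complex_norm_square)
  then show ?thesis by (simp add: cinner_def)
qed

lemma cinner_diff_left: "cinner (x - y) z = cinner x z - cinner y z"
  by (simp add: cinner_def sum_subtractf algebra_simps)

lemma cinner_scale_left: "cinner (c *s x) y = c * cinner x y"
  by (simp add: cinner_def sum_distrib_left algebra_simps)

lemma cinner_scale_right: "cinner x (c *s y) = cnj c * cinner x y"
  by (simp add: cinner_def sum_distrib_left algebra_simps)

lemma norm_cinner_le: "cmod (cinner x y) \<le> norm x * norm y"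
proof -
  have "cmod (cinner x y) \<le> (\<Sum>i\<in>UNIV. \<bar>cmod (x $ i)\<bar> * \<bar>cmod (y $ i)\<bar>)"
    unfolding cinner_def by (rule sum_norm_le) (simp add: norm_mult)
  also have "\<dots> \<le> norm x * norm y"
    unfolding norm_vec_def by (rule L2_set_mult_ineq)
  finally show ?thesis .
qed

lemma mat_mult_vec: "mat z *v x = z *s (x :: complex ^ 'n)"
  by (simp add: vec_eq_iff matrix_vector_mult_def mat_def if_distrib[of "\<lambda>y. y * _"] cong: if_cong)

lemma scaleR_eq_smult: "r *\<^sub>R x = complex_of_real r *s (x :: complex ^ 'n)"
  by (simp add: vec_eq_iff scaleR_conv_of_real[where 'a = complex])

text \<open>Homogeneity carries facts about unit vectors over to all vectors; at
  \<open>v = 0\<close> any point of the nonempty numerical range serves.\<close>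

lemma cinner_eq_numerical_range:
  fixes A :: "complex ^ 'n ^ 'n"
  obtains w where "w \<in> numerical_range A" "cinner (A *v v) v = w * complex_of_real ((norm v)\<^sup>2)"
proof (cases "v = 0")
  case True
  obtain w where "w \<in> numerical_range A" using numerical_range_nonempty[of A] by blast
  moreover have "cinner (A *v v) v = w * complex_of_real ((norm v)\<^sup>2)"
    using True by (simp add: cinner_def)
  ultimately show ?thesis by (rule that)
next
  case False
  define u where "u = (1 / norm v) *\<^sub>R v"
  have v: "v = complex_of_real (norm v) *s u"
    using False by (simp add: u_def scaleR_eq_smult vector_smult_assoc flip: of_real_mult)
  have u: "norm u = 1" using False by (simp add: u_def)
  have "cinner (A *v v) v = cinner (A *v u) u * complex_of_real ((norm v)\<^sup>2)"
    by (subst (1 2) v) (simp add: vector_scalar_commute cinner_scale_left cinner_scale_right power2_eq_square)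
  moreover have "cinner (A *v u) u \<in> numerical_range A"
    using u by (auto simp: numerical_range_def)
  ultimately show ?thesis using that by blast
qed

lemma numerical_radius_ge:
  assumes "w \<in> numerical_range A" shows "cmod w \<le> numerical_radius A"
  using numerical_radius_attained[of A] assms by auto

lemma norm_cinner_le_numerical_radius:
  "cmod (cinner (A *v v) v) \<le> numerical_radius A * (norm v)\<^sup>2"
proof -
  obtain w where w: "w \<in> numerical_range A" "cinner (A *v v) v = w * complex_of_real ((norm v)\<^sup>2)"
    by (rule cinner_eq_numerical_range)
  then have "cmod (cinner (A *v v) v) = cmod w * (norm v)\<^sup>2"
    by (simp only: norm_mult norm_of_real) simp
  then show ?thesis
    using numerical_radius_ge[OF w(1)] by (simp add: mult_right_mono)
qed


text \<open>The imaginary part of \<open>A\<close> is the real part of \<open>- \<i>\<close> times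
  \<open>A\<close>, which reduces the claim to \<open>cinner_Re_mat\<close>.\<close>

lemma cinner_Im_mat: "cinner (Im_mat A *v x) x = complex_of_real (Im (cinner (A *v x) x))"
proof -
  define B where "B = (\<chi> i j. - \<i> * A $ i $ j)"
  have "Im_mat A = Re_mat B"
    by (simp add: vec_eq_iff Im_mat_def Re_mat_def B_def adjoint_mat_def field_simps)
  moreover have "cinner (B *v x) x = - \<i> * cinner (A *v x) x"
    by (simp add: B_def cinner_def matrix_vector_mult_def sum_distrib_left sum_distrib_right sum_negf mult.assoc)
  ultimately show ?thesis
    by (simp add: cinner_Re_mat)
qed

lemma numerical_range_accretive_dissipative:
  assumes "accretive_dissipative A" "w \<in> numerical_range A"
  shows "Re w > 0" "Im w > 0"
proof -
  obtain x where x: "w = cinner (A *v x) x" "norm x = 1"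
    using assms(2) by (auto simp: numerical_range_def)
  have "cinner (Re_mat A *v x) x \<in> numerical_range (Re_mat A)"
    "cinner (Im_mat A *v x) x \<in> numerical_range (Im_mat A)"
    using x by (auto simp: numerical_range_def)
  then show "Re w > 0" "Im w > 0"
    using assms(1) x
    by (auto simp: accretive_dissipative_def positive_definite_def cinner_Re_mat cinner_Im_mat)
qed

subsection \<open>The resolvent\<close>

lemma resolvent_iff_not_eigenvalue: "z \<in> resolvent_set A \<longleftrightarrow> \<not> eigenvalue_mat A z"
proof
  assume "z \<in> resolvent_set A"
  then have inv: "\<exists>B. B ** (mat z - A) = mat 1"
    by (auto simp: resolvent_set_def invertible_left_inverse)
  show "\<not> eigenvalue_mat A z"
  proof
    assume "eigenvalue_mat A z"
    then obtain v where "v \<noteq> 0" "(mat z - A) *v v = 0"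
      by (auto simp: eigenvalue_mat_def matrix_vector_mult_diff_rdistrib mat_mult_vec)
    then show False using inv by (auto simp: matrix_left_invertible_ker)
  qed
qed (rule not_eigenvalue_resolvent)

lemma resolvent_mult:
  assumes "z \<in> resolvent_set A"
  shows "(mat z - A) *v (matrix_inv (mat z - A) *v b) = b"
    and "matrix_inv (mat z - A) *v ((mat z - A) *v b) = b"
proof -
  have "(mat z - A) ** matrix_inv (mat z - A) = mat 1 \<and> matrix_inv (mat z - A) ** (mat z - A) = mat 1"
    using assms unfolding resolvent_set_def matrix_inv_def invertible_def mem_Collect_eq by (rule someI_ex)
  then show "(mat z - A) *v (matrix_inv (mat z - A) *v b) = b"
    "matrix_inv (mat z - A) *v ((mat z - A) *v b) = b"
    by (simp_all add: matrix_vector_mul_assoc)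
qed

lemma det_resolvent_holomorphic: "(\<lambda>z. det (mat z - A)) holomorphic_on S" for A :: "complex ^ 'n ^ 'n"
proof -
  have "(\<lambda>z. (mat z - A) $ i $ j) holomorphic_on S" for i j
    by (cases "i = j") (auto simp: mat_def intro!: holomorphic_intros)
  then show ?thesis unfolding det_def by (intro holomorphic_intros)
qed

lemma large_resolvent:
  assumes "cmod z > numerical_radius A" shows "z \<in> resolvent_set A"
proof (rule not_eigenvalue_resolvent, rule notI)
  assume "eigenvalue_mat A z"
  then show False
    using numerical_radius_ge[OF eigenvalue_in_numerical_range] assms by fastforce
qed

text \<open>Eigenvalues are zeros of the entire function det (z - A), which does not vanish beyond
  the numerical radius. They all lie in the compact numerical range, so the identity theorem leaves
  only finitely many.\<close>

lemma finite_eigenvalues: "finite {z. eigenvalue_mat A z}" for A :: "complex ^ 'n ^ 'n"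
proof -
  let ?d = "\<lambda>z. det (mat z - A)"
  have ev: "eigenvalue_mat A z \<longleftrightarrow> ?d z = 0" for z
    using resolvent_iff_not_eigenvalue[of z A]
    by (auto simp: resolvent_set_def invertible_det_nz)
  have z0: "?d (complex_of_real (numerical_radius A + 1)) \<noteq> 0"
  proof -
    have "cmod (complex_of_real (numerical_radius A + 1)) > numerical_radius A"
      by (simp only: norm_of_real)
    from large_resolvent[OF this] show ?thesis
      by (simp add: resolvent_set_def invertible_det_nz)
  qed
  show ?thesis
  proof (cases "?d constant_on UNIV")
    case True
    then have "?d z \<noteq> 0" for z using z0 unfolding constant_on_def by (metis UNIV_I)
    then show ?thesis by (simp add: ev)
  next
    case False
    have "finite {z \<in> numerical_range A. ?d z = 0}"
      by (rule holomorphic_compact_finite_zeros[OF det_resolvent_holomorphic _ _ numerical_range_compact _ False]) auto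
    moreover have "{z. eigenvalue_mat A z} \<subseteq> {z \<in> numerical_range A. ?d z = 0}"
      using eigenvalue_in_numerical_range ev by auto
    ultimately show ?thesis by (rule rev_finite_subset)
  qed
qed

text \<open>By Cramer's rule each component is a quotient of two determinants whose entries are
  affine in \<open>z\<close>.\<close>

lemma resolvent_vector_holomorphic:
  fixes A :: "complex ^ 'n ^ 'n"
  shows "(\<lambda>z. (matrix_inv (mat z - A) *v b) $ k) holomorphic_on resolvent_set A"
proof -
  let ?N = "\<lambda>z. det (\<chi> i j. if j = k then b $ i else (mat z - A) $ i $ j)"
  have "(matrix_inv (mat z - A) *v b) $ k = ?N z / det (mat z - A)" if "z \<in> resolvent_set A" for z
  proof -
    have "det (mat z - A) \<noteq> 0" using that by (simp add: resolvent_set_def invertible_det_nz)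
    from cramer[OF this] resolvent_mult(1)[OF that, of b]
    have "matrix_inv (mat z - A) *v b =
      (\<chi> k. det (\<chi> i j. if j = k then b $ i else (mat z - A) $ i $ j) / det (mat z - A))"
      by blast
    then show ?thesis by (simp add: vec_eq_iff)
  qed
  moreover have "(\<lambda>z. ?N z / det (mat z - A)) holomorphic_on resolvent_set A"
  proof (rule holomorphic_on_divide[OF _ det_resolvent_holomorphic])
    have "(\<lambda>z. if j = k then b $ i else (mat z - A) $ i $ j) holomorphic_on resolvent_set A" for i j
      by (cases "j = k"; cases "i = j") (auto simp: mat_def intro!: holomorphic_intros)
    then show "?N holomorphic_on resolvent_set A"
      unfolding det_def by (auto intro!: holomorphic_intros)
  qed (simp add: resolvent_set_def invertible_det_nz)
  ultimately show ?thesis by (simp cong: holomorphic_cong)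
qed

section \<open>Contour integrals of the resolvent\<close>

text \<open>The residue theorem writes both integrals as the same combination of residues at
  \<open>P\<close>. This serves to exchange contours around the eigenvalues.\<close>

lemma contour_integral_eq_if_winding_number_eq:
  assumes S: "open S" "connected S" and P: "finite P" and f: "f holomorphic_on S - P"
    and g: "valid_path g" "pathfinish g = pathstart g" "path_image g \<subseteq> S - P"
      "\<And>z. z \<notin> S \<Longrightarrow> winding_number g z = 0"
    and h: "valid_path h" "pathfinish h = pathstart h" "path_image h \<subseteq> S - P"
      "\<And>z. z \<notin> S \<Longrightarrow> winding_number h z = 0"
    and eq: "\<And>p. p \<in> P \<Longrightarrow> winding_number g p = winding_number h p"
  shows "contour_integral g f = contour_integral h f"
  using Residue_theorem[OF S P f g(1-3)] Residue_theorem[OF S P f h(1-3)] g(4) h(4) eq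
  by (simp cong: sum.cong)

lemma resolvent_set_eq: "resolvent_set A = - {z. eigenvalue_mat A z}"
  by (auto simp: resolvent_iff_not_eigenvalue)

lemma open_resolvent_set: "open (resolvent_set A)"
  unfolding resolvent_set_eq by (intro open_Compl finite_imp_closed finite_eigenvalues)

text \<open>A scalar matrix element of the resolvent, so that scalar contour integration and the
  residue theorem apply.\<close>

definition resolvent_form :: "complex ^ 'n ^ 'n \<Rightarrow> complex ^ 'n \<Rightarrow> complex ^ 'n \<Rightarrow> complex \<Rightarrow> complex" where
  "resolvent_form A b x z = cinner (matrix_inv (mat z - A) *v b) x"

lemma resolvent_form_holomorphic: "resolvent_form A b x holomorphic_on resolvent_set A"
  unfolding resolvent_form_def[abs_def] cinner_def by (intro holomorphic_intros resolvent_vector_holomorphic)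

lemma resolvent_form_has_contour_integral:
  assumes "valid_path g" "path_image g \<subseteq> resolvent_set A"
  shows "(resolvent_form A b x has_contour_integral
    contour_integral g (resolvent_form A b x)) g"
  by (rule has_contour_integral_integral
      [OF contour_integrable_holomorphic_simple[OF resolvent_form_holomorphic open_resolvent_set assms]])

text \<open>Pair \<open>z *s y - A *v y = b\<close> with \<open>y\<close>: the numerical radius
  controls \<open>cinner (A *v y) y\<close>, and Cauchy-Schwarz bounds
  \<open>cinner b y\<close>.\<close>

lemma norm_resolvent_le:
  assumes "cmod z > numerical_radius A"
  shows "norm (matrix_inv (mat z - A) *v b) \<le> norm b / (cmod z - numerical_radius A)"
proof -
  define y where "y = matrix_inv (mat z - A) *v b"
  have b: "z *s y - A *v y = b"
    using resolvent_mult(1)[OF large_resolvent[OF assms], of b]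
    by (simp add: y_def matrix_vector_mult_diff_rdistrib mat_mult_vec)
  have "cinner b y = z * (norm y)\<^sup>2 - cinner (A *v y) y"
    unfolding b[symmetric] by (simp add: cinner_diff_left cinner_scale_left cinner_self)
  then have "cmod z * (norm y)\<^sup>2 - cmod (cinner (A *v y) y) \<le> cmod (cinner b y)"
    using norm_triangle_ineq2[of "z * (norm y)\<^sup>2" "cinner (A *v y) y"]
    by (simp add: norm_mult norm_power)
  also have "\<dots> \<le> norm b * norm y" by (rule norm_cinner_le)
  finally have "(cmod z - numerical_radius A) * norm y * norm y \<le> norm b * norm y"
    using norm_cinner_le_numerical_radius[of A y] by (simp add: power2_eq_square algebra_simps)
  then have "(cmod z - numerical_radius A) * norm y \<le> norm b"
    by (cases "norm y = 0") (auto simp: mult_le_cancel_right)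
  then show ?thesis using assms by (simp add: y_def pos_le_divide_eq mult.commute)
qed

text \<open>The functional calculus at the constant function 1: the normalised Cauchy integral of
  the resolvent is the identity matrix.\<close>

lemma contour_integral_resolvent_form:
  fixes A :: "complex ^ 'n ^ 'n"
  assumes g: "valid_path g" "pathfinish g = pathstart g" "path_image g \<subseteq> resolvent_set A"
    and w: "\<And>p. eigenvalue_mat A p \<Longrightarrow> winding_number g p = 1"
  shows "contour_integral g (resolvent_form A b x) = 2 * of_real pi * \<i> * cinner b x"
    (is "contour_integral g ?f = ?c")
proof -
  let ?\<omega> = "numerical_radius A"
  have \<omega>: "?\<omega> \<ge> 0"
    using numerical_radius_attained[of A] norm_ge_zero by metis
  have hol: "?f holomorphic_on UNIV - {z. eigenvalue_mat A z}"
    using resolvent_form_holomorphic[of A b x] by (simp add: resolvent_set_eq Compl_eq_Diff_UNIV)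
  have "linear ((*v) A)"
    by (auto intro!: linearI simp: matrix_vector_right_distrib scaleR_eq_smult vector_scalar_commute)
  then have "bounded_linear ((*v) A)" by (simp add: linear_conv_bounded_linear)
  then obtain K where K: "K > 0" "\<And>v. norm (A *v v) \<le> norm v * K"
    using bounded_linear.pos_bounded by blast
  \<comment> \<open>deform to a large circle, where \<open>z \<langle>(z - A)\<^bsup>-1\<^esup>b, x\<rangle> = \<langle>b, x\<rangle> + O(1/|z|)\<close>\<close>
  have bound: "cmod (contour_integral g ?f - ?c) \<le> 2 * pi * (norm b * K * norm x) / (\<rho> - ?\<omega>)" if \<rho>: "\<rho> > ?\<omega>" for \<rho>
  proof -
    let ?C = "circlepath 0 \<rho>"
    have \<rho>0: "\<rho> > 0" using \<rho> \<omega> by simp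
    have img: "path_image ?C \<subseteq> resolvent_set A"
      using \<rho> \<rho>0 by (auto intro!: large_resolvent)
    have "contour_integral g ?f = contour_integral ?C ?f"
    proof (rule contour_integral_eq_if_winding_number_eq[OF _ _ finite_eigenvalues hol])
      fix p assume p: "p \<in> {z. eigenvalue_mat A z}"
      then have "cmod p < \<rho>"
        using numerical_radius_ge[OF eigenvalue_in_numerical_range, of A p] \<rho> by simp
      then have "winding_number ?C p = 1" by (intro winding_number_circlepath) auto
      then show "winding_number g p = winding_number ?C p" using w p by simp
    qed (use g img in \<open>auto simp: resolvent_set_eq\<close>)
    moreover have "(?f has_contour_integral contour_integral ?C ?f) ?C"
      using img by (intro resolvent_form_has_contour_integral) auto
    moreover have "((\<lambda>z. cinner b x / (z - 0)) has_contour_integral ?c) ?C"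
      using has_contour_integral_lmul[OF Cauchy_integral_circlepath_simple[of "\<lambda>_. 1" 0 \<rho> 0], of "cinner b x"] \<rho>0
      by (simp add: mult_ac)
    ultimately have "((\<lambda>z. ?f z - cinner b x / (z - 0)) has_contour_integral contour_integral g ?f - ?c) ?C"
      by (auto intro: has_contour_integral_diff)
    then have "cmod (contour_integral g ?f - ?c) \<le>
        (norm b * K * norm x) / ((\<rho> - ?\<omega>) * \<rho>) * (2 * pi * \<rho>)"
    proof (rule has_contour_integral_bound_circlepath)
      fix z :: complex assume "cmod (z - 0) = \<rho>"
      then have z: "cmod z = \<rho>" by simp
      define y where "y = matrix_inv (mat z - A) *v b"
      have zr: "cmod z > ?\<omega>" using z \<rho> by simp
      have ny: "norm y \<le> norm b / (\<rho> - ?\<omega>)"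
        using norm_resolvent_le[OF zr, of b] z by (simp add: y_def)
      have "z *s y - A *v y = b"
        using resolvent_mult(1)[OF large_resolvent[OF zr], of b]
        by (simp add: y_def matrix_vector_mult_diff_rdistrib mat_mult_vec)
      then have "z * cinner y x - cinner (A *v y) x = cinner b x"
        by (metis cinner_diff_left cinner_scale_left)
      moreover have "z \<noteq> 0" using z \<rho>0 by auto
      ultimately have "cinner y x - cinner b x / z = cinner (A *v y) x / z"
        by (simp add: field_simps)
      moreover have "cmod (cinner (A *v y) x) \<le> norm b / (\<rho> - ?\<omega>) * K * norm x"
      proof -
        have "cmod (cinner (A *v y) x) \<le> norm (A *v y) * norm x" by (rule norm_cinner_le)
        also have "\<dots> \<le> norm y * K * norm x" by (intro mult_right_mono K) auto
        also have "\<dots> \<le> norm b / (\<rho> - ?\<omega>) * K * norm x"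
          using K(1) by (intro mult_right_mono ny) auto
        finally show ?thesis .
      qed
      ultimately show "cmod (?f z - cinner b x / (z - 0)) \<le> (norm b * K * norm x) / ((\<rho> - ?\<omega>) * \<rho>)"
        using z \<rho>0 divide_right_mono[of "cmod (cinner (A *v y) x)" "norm b / (\<rho> - ?\<omega>) * K * norm x" \<rho>]
        by (simp add: resolvent_form_def norm_divide y_def[symmetric])
    qed (use \<rho> \<rho>0 K(1) in auto)
    also have "\<dots> = 2 * pi * (norm b * K * norm x) / (\<rho> - ?\<omega>)"
      using \<rho>0 by simp
    finally show ?thesis .
  qed
  \<comment> \<open>The left-hand side of \<open>bound\<close> does not depend on
    \<open>\<rho>\<close>, so the radius may tend to infinity.\<close>
  have "((\<lambda>\<rho>. 2 * pi * (norm b * K * norm x) / (\<rho> - ?\<omega>)) \<longlongrightarrow> 0) at_top"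
    by real_asymp
  then have "cmod (contour_integral g ?f - ?c) \<le> 0"
    by (rule tendsto_lowerbound) (use bound in \<open>auto intro: eventually_mono[OF eventually_gt_at_top[of ?\<omega>]]\<close>)
  then show ?thesis by simp
qed

text \<open>The functional calculus at 1/(z + a). With R(z) = (z - A)^-1, the identity R(z)x/(z + a)
  = R(z)y - y/(z + a) reduces it to the constant function 1, because the last term integrates to
  0.\<close>

lemma contour_integral_resolvent_form_divide:
  fixes A :: "complex ^ 'n ^ 'n"
  assumes g: "valid_path g" "pathfinish g = pathstart g" "path_image g \<subseteq> resolvent_set A"
    and w: "\<And>p. eigenvalue_mat A p \<Longrightarrow> winding_number g p = 1"
    and y: "a *s y + A *v y = x"
    and a: "((\<lambda>z. 1 / (z + a)) has_contour_integral 0) g" "- a \<notin> path_image g"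
  shows "((\<lambda>z. resolvent_form A x v z / (z + a)) has_contour_integral
    2 * of_real pi * \<i> * cinner y v) g"
proof -
  have "(resolvent_form A y v has_contour_integral
      2 * of_real pi * \<i> * cinner y v) g"
    using resolvent_form_has_contour_integral[OF g(1,3), of y v]
    by (simp only: contour_integral_resolvent_form[OF g w])
  from has_contour_integral_diff[OF this has_contour_integral_lmul[OF a(1), of "cinner y v"]]
  have "((\<lambda>z. resolvent_form A y v z - cinner y v * (1 / (z + a))) has_contour_integral
      2 * of_real pi * \<i> * cinner y v) g" by simp
  then show ?thesis
  proof (rule has_contour_integral_eq)
    fix z assume z: "z \<in> path_image g"
    then have za: "z + a \<noteq> 0" using a(2) by (metis add.commute add.inverse_unique)
    have zr: "z \<in> resolvent_set A" using z g by auto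
    let ?R = "matrix_inv (mat z - A)"
    have "(mat z - A) *v y = (z + a) *s y - x"
      using y by (simp add: matrix_vector_mult_diff_rdistrib mat_mult_vec vector_sadd_rdistrib flip: y)
    then have "?R *v ((z + a) *s y - x) = y"
      using resolvent_mult(2)[OF zr, of y] by simp
    then have "(z + a) * cinner (?R *v y) v - cinner (?R *v x) v = cinner y v"
      by (metis cinner_diff_left cinner_scale_left matrix_vector_mult_diff_distrib vector_scalar_commute)
    then show "resolvent_form A y v z - cinner y v * (1 / (z + a)) = resolvent_form A x v z / (z + a)"
      using za by (simp add: resolvent_form_def field_simps)
  qed
qed

subsection \<open>The truncated integral representation of powers\<close>

text \<open>The image of the slit plane under \<open>Ln\<close>. Its convexity provides primitives
  of holomorphic functions.\<close>

definition strip :: "complex set" where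
  "strip = {y. \<bar>Im y\<bar> < pi}"

text \<open>
  In the coordinate \<open>w = e\<^sup>v\<close> the truncated integral of \<open>e\<^bsup>tu\<^esup> w/(e\<^sup>u + w)\<close> is \<open>e\<^bsup>tv\<^esup>\<close> times the
  integral of the kernel over the translated segment \<open>[-n - v, n - v]\<close>, so it depends on \<open>v\<close> only
  through that factor and two end pieces, on which the kernel is exponentially small.
\<close>

definition power_kernel :: "real \<Rightarrow> complex \<Rightarrow> complex" where
  "power_kernel t y = exp (of_real t * y) / (1 + exp y)"

definition power_truncation :: "real \<Rightarrow> real \<Rightarrow> complex \<Rightarrow> complex" where
  "power_truncation t n w =
    contour_integral (linepath (of_real (- n)) (of_real n)) (\<lambda>u. exp (of_real t * u) * (w / (exp u + w)))"

lemma convex_strip: "convex strip"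
proof -
  have "strip = {y. Im y < pi} \<inter> {y. Im y > - pi}" by (auto simp: strip_def)
  then show ?thesis
    by (metis convex_Int convex_halfspace_Im_lt convex_halfspace_Im_gt)
qed

lemma open_strip: "open strip"
  unfolding strip_def by (intro open_Collect_less continuous_intros)

text \<open>On the strip \<open>Ln\<close> inverts \<open>exp\<close>, while \<open>Ln (- 1)\<close>
  has imaginary part pi and so lies on the boundary.\<close>

lemma one_plus_exp_nonzero:
  assumes "y \<in> strip" shows "1 + exp y \<noteq> 0"
proof
  assume "1 + exp y = 0"
  then have "exp y = - 1" by (simp add: add_eq_0_iff)
  moreover have "Ln (exp y) = y" using assms by (intro Ln_exp) (auto simp: strip_def)
  ultimately have "Im y = pi" by auto
  then show False using assms by (simp add: strip_def)
qed

text \<open>Differences of \<open>F\<close> are integrals of the kernel along any path in the strip,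
  so translated segments are handled through their endpoints alone.\<close>

lemma power_kernel_primitive:
  obtains F where "\<And>y. y \<in> strip \<Longrightarrow> (F has_field_derivative power_kernel t y) (at y)"
proof -
  have "power_kernel t holomorphic_on strip"
    unfolding power_kernel_def
    by (intro holomorphic_intros) (use one_plus_exp_nonzero in auto)
  then obtain F where F: "\<And>y. y \<in> strip \<Longrightarrow> (F has_field_derivative power_kernel t y) (at y within strip)"
    using holomorphic_convex_primitive'[OF convex_strip open_strip] by blast
  then show ?thesis using that at_within_open[OF _ open_strip] by metis
qed

text \<open>On the right the denominator has modulus at least half of exp (Re y), which leaves decay
  at rate 1 - t; on the left it has modulus at least 1/2, which leaves decay at rate t. Both
  estimates use exp a \<ge> 2, ensured by a \<ge> 1.\<close>

lemma norm_power_kernel_le: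
  assumes t: "0 < t" "t < 1" and a: "a \<ge> 1" "\<bar>Re y\<bar> \<ge> a"
  shows "cmod (power_kernel t y) \<le> 2 * exp (- min t (1 - t) * a)"
proof (cases "Re y \<ge> 0")
  case True
  then have y: "Re y \<ge> a" using a by simp
  have e: "exp (Re y) \<ge> 2" using y a exp_ge_add_one_self[of "Re y"] by linarith
  have "exp (Re y) / 2 \<le> cmod (1 + exp y)"
    using norm_diff_ineq[of "exp y" 1] e by (simp add: add.commute)
  then have "cmod (power_kernel t y) \<le> exp (t * Re y) / (exp (Re y) / 2)"
    unfolding power_kernel_def norm_divide using e by (intro frac_le) auto
  also have "\<dots> = 2 * exp (- (1 - t) * Re y)"
    by (simp add: exp_diff algebra_simps exp_minus field_simps)
  finally have "cmod (power_kernel t y) \<le> 2 * exp (- (1 - t) * Re y)" .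
  moreover have "(1 - t) * Re y \<ge> min t (1 - t) * a"
    using t a y by (intro mult_mono) auto
  then have "exp (- (1 - t) * Re y) \<le> exp (- min t (1 - t) * a)"
    by (simp only: mult_minus_left exp_le_cancel_iff neg_le_iff_le)
  ultimately show ?thesis by linarith
next
  case False
  then have y: "Re y \<le> - a" using a by simp
  have "exp (- Re y) \<ge> 2" using y a exp_ge_add_one_self[of "- Re y"] by linarith
  then have e: "exp (Re y) \<le> 1 / 2" by (simp add: exp_minus field_simps)
  have "1 / 2 \<le> cmod (1 + exp y)"
    using norm_diff_ineq[of 1 "exp y"] e by simp
  then have "cmod (power_kernel t y) \<le> exp (t * Re y) / (1 / 2)"
    unfolding power_kernel_def norm_divide by (intro frac_le) auto
  then have "cmod (power_kernel t y) \<le> 2 * exp (t * Re y)" by simp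
  moreover have "t * (- Re y) \<ge> min t (1 - t) * a"
    using t a y by (intro mult_mono) auto
  then have "exp (t * Re y) \<le> exp (- min t (1 - t) * a)" by simp
  ultimately show ?thesis by linarith
qed

text \<open>The integrand is e^(tv) times the kernel at \<open>u - v\<close>, so the integral is
  obtained from a primitive at the endpoints of the segment translated by
  \<open>- v\<close>.\<close>

lemma power_truncation_exp:
  assumes F: "\<And>y. y \<in> strip \<Longrightarrow> (F has_field_derivative power_kernel t y) (at y)"
    and v: "v \<in> strip"
  shows "power_truncation t n (exp v) = exp (of_real t * v) * (F (of_real n - v) - F (of_real (- n) - v))"
proof -
  let ?S = "{u. u - v \<in> strip}" and ?l = "linepath (complex_of_real (- n)) (of_real n)"
  have img: "path_image ?l \<subseteq> ?S"
  proof
    fix u assume "u \<in> path_image ?l"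
    then have "Im u = 0" by (auto simp: closed_segment_def)
    then show "u \<in> ?S" using v by (simp add: strip_def)
  qed
  have "((\<lambda>u. exp (of_real t * v) * F (u - v)) has_field_derivative
      exp (of_real t * u) * (exp v / (exp u + exp v))) (at u within ?S)" if "u \<in> ?S" for u
  proof -
    have "((\<lambda>u. F (u - v)) has_field_derivative power_kernel t (u - v) * (1 - 0)) (at u within ?S)"
      using that by (intro DERIV_chain2[OF F] derivative_intros) auto
    from DERIV_cmult[OF this, of "exp (of_real t * v)"]
    have "((\<lambda>u. exp (of_real t * v) * F (u - v)) has_field_derivative
      exp (of_real t * v) * power_kernel t (u - v)) (at u within ?S)" by simp
    moreover have "exp (of_real t * v) * power_kernel t (u - v) = exp (of_real t * u) * (exp v / (exp u + exp v))"
      using one_plus_exp_nonzero[of "u - v"] that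
      by (simp add: power_kernel_def exp_diff right_diff_distrib divide_simps add.commute)
    ultimately show ?thesis by simp
  qed
  from contour_integral_primitive[OF this _ img]
  show ?thesis unfolding power_truncation_def
    by (simp add: contour_integral_unique right_diff_distrib)
qed

text \<open>Read off from the primitive formula at \<open>v = Ln w\<close>, without differentiating
  under the integral sign.\<close>

lemma power_truncation_holomorphic:
  "power_truncation t n holomorphic_on - \<real>\<^sub>\<le>\<^sub>0"
proof -
  obtain F where F: "\<And>y. y \<in> strip \<Longrightarrow> (F has_field_derivative power_kernel t y) (at y)"
    using power_kernel_primitive[of t] by blast
  have Fhol: "F holomorphic_on strip"
    using F by (auto simp: holomorphic_on_def field_differentiable_def intro: DERIV_subset)
  have strip: "Ln w \<in> strip" "complex_of_real m - Ln w \<in> strip" if "w \<notin> \<real>\<^sub>\<le>\<^sub>0" for w m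
    using that Im_Ln_less_pi[OF that] mpi_less_Im_Ln[of w] by (force simp: strip_def)+
  have "(\<lambda>w. exp (of_real t * Ln w) * (F (of_real n - Ln w) - F (of_real (- n) - Ln w))) holomorphic_on - \<real>\<^sub>\<le>\<^sub>0"
    by (intro holomorphic_intros holomorphic_on_compose_gen[OF _ Fhol, unfolded o_def]) (use strip strip(2)[where m = "- n"] in auto)
  moreover have "exp (of_real t * Ln w) * (F (of_real n - Ln w) - F (of_real (- n) - Ln w)) = power_truncation t n w"
    if "w \<in> - \<real>\<^sub>\<le>\<^sub>0" for w
    using power_truncation_exp[OF F, of "Ln w"] strip[of w] that by (cases "w = 0") auto
  ultimately show ?thesis by (rule holomorphic_transform)
qed

text \<open>Up to the factor w^t, the truncations at \<open>w\<close> and at 1 integrate the same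
  kernel over segments that differ by the translation \<open>Ln w\<close>, so only two end pieces
  remain. The bound depends on \<open>w\<close> only through \<open>M\<close>, hence is uniform on
  compact sets.\<close>

lemma power_truncation_approx:
  assumes t: "0 < t" "t < 1" and w: "w \<notin> \<real>\<^sub>\<le>\<^sub>0" and M: "cmod (Ln w) \<le> M" and n: "n \<ge> M + 1"
  shows "cmod (power_truncation t n w - w powr of_real t * power_truncation t n 1)
    \<le> exp M * (4 * M * exp (- min t (1 - t) * (n - M)))"
proof -
  obtain F where F: "\<And>y. y \<in> strip \<Longrightarrow> (F has_field_derivative power_kernel t y) (at y)"
    using power_kernel_primitive[of t] by blast
  define v where "v = Ln w"
  have w0: "w \<noteq> 0" using w by auto
  have v: "v \<in> strip" using w w0 Im_Ln_less_pi[OF w] mpi_less_Im_Ln[of w] by (force simp: v_def strip_def)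
  have ev: "exp v = w" using w0 by (simp add: v_def)
  have M0: "M \<ge> 0" "cmod v \<le> M" using M norm_ge_zero[of "Ln w"] by (auto simp: v_def intro: order_trans[OF norm_ge_zero])
  have Rv: "\<bar>Re v\<bar> \<le> M" using abs_Re_le_cmod[of v] M0 by simp
  \<comment> \<open>A bound for the kernel where the real part has modulus at least
    \<open>n - M\<close>; each end piece lies in one of the two half-planes of such points.\<close>
  define B where "B = 2 * exp (- min t (1 - t) * (n - M))"
  have bound: "cmod (F p - F q) \<le> B * cmod (p - q)"
    if S: "convex S" "p \<in> S" "q \<in> S" "p \<in> strip" "q \<in> strip" "\<And>y. y \<in> S \<Longrightarrow> \<bar>Re y\<bar> \<ge> n - M" for S p q
  proof (rule field_differentiable_bound[of "S \<inter> strip"])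
    show "(F has_field_derivative power_kernel t y) (at y within S \<inter> strip)" if "y \<in> S \<inter> strip" for y
      using F that by (auto intro: has_field_derivative_at_within)
    show "cmod (power_kernel t y) \<le> B" if "y \<in> S \<inter> strip" for y
      unfolding B_def using that S n M0 by (intro norm_power_kernel_le t) auto
  qed (use S convex_strip in \<open>auto simp: convex_Int\<close>)
  have str: "complex_of_real m \<in> strip" "complex_of_real m - v \<in> strip" for m
    using v by (auto simp: strip_def)
  define d where "d = (F (of_real n - v) - F (of_real n)) - (F (of_real (- n) - v) - F (of_real (- n)))"
  have "cmod (F (of_real n - v) - F (of_real n)) \<le> B * cmod (of_real n - v - of_real n)"
    by (rule bound[OF convex_halfspace_Re_ge[of "n - M"]]) (use str Rv M0 n in auto)
  moreover have "cmod (F (of_real (- n) - v) - F (of_real (- n))) \<le> B * cmod (of_real (- n) - v - of_real (- n))"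
    by (rule bound[OF convex_halfspace_Re_le[of "- (n - M)"]]) (use str[of "- n"] Rv M0 n in auto)
  moreover have "B * cmod v \<le> B * M" using M0 by (intro mult_left_mono) (auto simp: B_def)
  ultimately have d: "cmod d \<le> 2 * (B * M)"
    unfolding d_def by (intro norm_triangle_le_diff) simp
  have one: "power_truncation t n 1 = F (of_real n) - F (of_real (- n))"
    using power_truncation_exp[OF F, of 0 n] by (simp add: strip_def)
  have "w powr of_real t = exp (of_real t * v)" using w0 by (simp add: powr_def v_def)
  then have "power_truncation t n w - w powr of_real t * power_truncation t n 1 = exp (of_real t * v) * d"
    using power_truncation_exp[OF F v, of n] unfolding ev d_def one
    by (simp add: algebra_simps)
  moreover have "cmod (exp (of_real t * v)) \<le> exp M"
  proof -
    have "t * Re v \<le> t * \<bar>Re v\<bar>" using t by (intro mult_left_mono) auto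
    also have "\<dots> \<le> 1 * M" using t Rv by (intro mult_mono) auto
    finally have "t * Re v \<le> M" by simp
    then show ?thesis by simp
  qed
  ultimately have "cmod (power_truncation t n w - w powr of_real t * power_truncation t n 1) \<le> exp M * (2 * (B * M))"
    using d by (simp only: norm_mult) (intro mult_mono; simp)
  then show ?thesis by (simp add: B_def mult_ac)
qed

lemma Re_contour_integral_linepath_mono:
  fixes a b :: real
  assumes "a < b"
    and f: "f contour_integrable_on linepath (of_real a) (of_real b)"
    and g: "g contour_integrable_on linepath (of_real a) (of_real b)"
    and le: "\<And>u. u \<in> {a..b} \<Longrightarrow> Re (f (of_real u)) \<le> Re (g (of_real u))"
  shows "Re (contour_integral (linepath (of_real a) (of_real b)) f) \<le>
    Re (contour_integral (linepath (of_real a) (of_real b)) g)"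
proof -
  have I: "((\<lambda>u. Re (h (of_real u))) has_integral
      Re (contour_integral (linepath (of_real a) (of_real b)) h)) {a..b}"
    if "h contour_integrable_on linepath (of_real a) (of_real b)" for h
    using has_contour_integral_integral[OF that] \<open>a < b\<close>
    by (intro has_integral_Re) (simp add: has_contour_integral_linepath_Reals_iff)
  show ?thesis by (rule has_integral_le[OF I[OF f] I[OF g] le])
qed

lemma exp_of_real_plus_nonzero:
  assumes "w \<notin> \<real>\<^sub>\<le>\<^sub>0" "u \<in> \<real>" shows "exp u + w \<noteq> 0"
proof
  assume "exp u + w = 0"
  then have "w = - exp u" by (simp add: add_eq_0_iff)
  with assms show False
    by (auto simp: complex_nonpos_Reals_iff exp_of_real elim!: Reals_cases)
qed

lemma linepath_of_real_subset_Reals: "path_image (linepath (of_real a) (of_real b)) \<subseteq> (\<real> :: complex set)"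
  by (auto simp: closed_segment_def scaleR_conv_of_real)

lemma power_truncation_integrable:
  assumes "w \<notin> \<real>\<^sub>\<le>\<^sub>0"
  shows "(\<lambda>u. exp (of_real t * u) * (w / (exp u + w))) contour_integrable_on linepath (of_real a) (of_real b)"
  using linepath_of_real_subset_Reals[of a b] exp_of_real_plus_nonzero[OF assms]
  by (intro contour_integrable_continuous_linepath continuous_intros) auto

text \<open>The integrand at \<open>w = 1\<close> is positive on the real line, so for n \<ge> 1 the
  truncation is at least its value at n = 1. These numbers normalise the final estimate, where a
  uniform positive lower bound suffices.\<close>

lemma power_truncation_one:
  obtains C :: "real \<Rightarrow> real" and c where "c > 0"
    "\<And>n. n \<ge> 1 \<Longrightarrow> power_truncation t n 1 = of_real (C n) \<and> C n \<ge> c"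
proof -
  let ?k = "\<lambda>u. exp (t * u) * (1 / (exp u + 1)) :: real"
  define C where "C n = integral {- n..n} ?k" for n
  have pos: "exp u + (1::real) \<noteq> 0" for u :: real using exp_gt_zero[of u] by linarith
  have int: "?k integrable_on {a..b}" for a b
    using pos by (intro integrable_continuous_real continuous_intros) auto
  have eq: "power_truncation t n 1 = of_real (C n)" if "n \<ge> 1" for n
  proof -
    have "((\<lambda>u. complex_of_real (?k u)) has_integral of_real (C n)) {- n..n}"
      using integrable_integral[OF int] unfolding C_def by (rule has_integral_of_real)
    then show ?thesis
      using that unfolding power_truncation_def
      by (simp add: contour_integral_linepath_Reals_eq integral_unique flip: exp_of_real)
  qed
  have mono: "C n \<ge> C 1" if "n \<ge> 1" for n
    unfolding C_def using that int
    by (intro integral_subset_le) (auto intro!: divide_nonneg_pos add_pos_pos)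
  \<comment> \<open>On the interval from -1 to 1 the integrand is at least this positive
    constant.\<close>
  have "C 1 \<ge> integral {- 1..1} (\<lambda>u::real. exp (- \<bar>t\<bar>) * (1 / (exp 1 + 1)))"
    unfolding C_def
  proof (rule integral_le[OF _ int])
    fix u :: real assume u: "u \<in> {- 1..1}"
    have "\<bar>t * u\<bar> \<le> \<bar>t\<bar> * 1" unfolding abs_mult using u by (intro mult_left_mono) auto
    then show "exp (- \<bar>t\<bar>) * (1 / (exp 1 + 1)) \<le> ?k u"
      using u by (intro mult_mono frac_le add_mono) (auto intro: add_pos_pos)
  qed auto
  moreover have "integral {- 1..1} (\<lambda>u::real. exp (- \<bar>t\<bar>) * (1 / (exp 1 + 1))) > 0"
    by (simp add: add_pos_pos)
  ultimately have "C 1 > 0" by simp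
  then show ?thesis using that[of "C 1" C] eq mono by blast
qed

subsection \<open>Fractional powers of rotated matrices\<close>

text \<open>With B = e^(-i \<theta>) A, the right-hand side is the real part of the form of B (s +
  B)^-1 at \<open>x\<close>. The bound is \<open>inverse_form_le\<close> for B, regarded as a
  real-linear map.\<close>

lemma Re_resolvent_form_ge:
  fixes A :: "complex ^ 'n ^ 'n"
  assumes form: "\<And>v. Re (cis (- \<theta>) * cinner (A *v v) v) \<ge> 0"
      "\<And>v. Re (cis (- \<theta>) * cinner (A *v v) v) \<le> \<omega> * (norm v)\<^sup>2"
    and x: "norm x = 1" "Re (cis (- \<theta>) * cinner (A *v x) x) = \<omega>"
    and s: "s > 0" and a: "a = of_real s * cis \<theta>" "- a \<in> resolvent_set A"
  shows "\<omega> / (s + \<omega>) \<le> Re (1 + a * resolvent_form A x x (- a))"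
proof -
  define T where "T v = cis (- \<theta>) *s (A *v v)" for v
  have T: "linear T"
    by (auto intro!: linearI simp: T_def matrix_vector_right_distrib scaleR_eq_smult
        vector_scalar_commute vector_smult_assoc mult.commute vector_add_ldistrib)
  have inner_T: "inner (T v) v = Re (cis (- \<theta>) * cinner (A *v v) v)" for v
    unfolding T_def Re_cinner[symmetric] cinner_scale_left ..
  define r where "r = matrix_inv (mat (- a) - A) *v x"
  \<comment> \<open>The solution of \<open>s *\<^sub>R y + T y = x\<close>: multiplication by
    \<open>cis \<theta>\<close> turns s + T into a + A, and the sign comes from taking the resolvent
    at \<open>- a\<close>.\<close>
  define y where "y = - (cis \<theta> *s r)"
  have "- (a *s r) - A *v r = x"
    using resolvent_mult(1)[OF a(2), of x]
    by (simp add: r_def matrix_vector_mult_diff_rdistrib mat_mult_vec)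
  moreover have "s *\<^sub>R y = - (a *s r)"
    by (simp add: y_def a scaleR_eq_smult vector_smult_assoc)
  moreover have "T y = - (A *v r)"
  proof -
    have "y = (- cis \<theta>) *s r" by (simp add: y_def vec_eq_iff)
    then have "T y = (cis (- \<theta>) * (- cis \<theta>)) *s (A *v r)"
      unfolding T_def by (simp only: vector_scalar_commute vector_smult_assoc)
    also have "cis (- \<theta>) * (- cis \<theta>) = - 1" by (simp add: cis_mult)
    finally show ?thesis by (simp add: vec_eq_iff)
  qed
  ultimately have "s *\<^sub>R y + T y = x" by simp
  then have "inner y x \<le> 1 / (s + \<omega>)"
    by (intro inverse_form_le[OF T]) (use form x s in \<open>simp_all add: inner_T\<close>)
  then have "s * inner y x \<le> s * (1 / (s + \<omega>))" using s by (intro mult_left_mono) auto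
  moreover have "Re (a * cinner r x) = - (s * inner y x)"
  proof -
    have "cinner y x = - (cis \<theta> * cinner r x)"
      unfolding y_def by (simp add: cinner_def sum_negf sum_distrib_left mult.assoc)
    then have "a * cinner r x = - (of_real s * cinner y x)" by (simp add: a)
    then show ?thesis by (simp add: Re_cinner)
  qed
  moreover have "\<omega> \<ge> 0" using form(1)[of x] x by simp
  then have "\<omega> / (s + \<omega>) = 1 - s * (1 / (s + \<omega>))" using s by (simp add: field_simps)
  ultimately show ?thesis by (simp add: resolvent_form_def r_def)
qed

text \<open>A nonpositive multiple of \<open>cis \<theta>\<close> has nonpositive real part, since
  cos \<theta> is nonnegative.\<close>

lemma rotated_not_nonpos_Reals:
  assumes "Re z > 0" "\<bar>\<theta>\<bar> \<le> pi / 2"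
  shows "cis (- \<theta>) * z \<notin> \<real>\<^sub>\<le>\<^sub>0"
proof
  assume "cis (- \<theta>) * z \<in> \<real>\<^sub>\<le>\<^sub>0"
  then obtain r where r: "cis (- \<theta>) * z = of_real r" "r \<le> 0"
    by (auto elim: nonpos_Reals_cases)
  have "z = cis \<theta> * (cis (- \<theta>) * z)" by (simp add: cis_mult flip: mult.assoc)
  then have "Re z = r * cos \<theta>" by (simp add: r)
  moreover have "cos \<theta> \<ge> 0" using assms(2) by (intro cos_ge_zero) auto
  ultimately show False using assms(1) r(2) by (simp add: mult_nonpos_nonneg leD)
qed

text \<open>The argument of \<open>z\<close> has modulus below pi/2, so rotation by
  \<open>- \<theta>\<close> does not cross the branch cut.\<close>

lemma powr_rotated:
  assumes "Re z > 0" "\<bar>\<theta>\<bar> \<le> pi / 2"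
  shows "(cis (- \<theta>) * z) powr of_real t = cis (- (t * \<theta>)) * z powr of_real t"
proof -
  have z: "z \<noteq> 0" using assms(1) by auto
  have "\<bar>Im (Ln z)\<bar> < pi / 2" using assms(1) z Re_Ln_pos_lt by auto
  then have "\<bar>Im (Ln z - \<i> * \<theta>)\<bar> < pi" using assms(2) by auto
  moreover have "exp (Ln z - \<i> * \<theta>) = cis (- \<theta>) * z"
    using z by (simp add: exp_diff cis_conv_exp exp_minus field_simps)
  ultimately have L: "Ln (cis (- \<theta>) * z) = Ln z - \<i> * \<theta>"
    by (intro Ln_unique) auto
  have "(cis (- \<theta>) * z) powr of_real t = exp (- (\<i> * (t * \<theta>)) + of_real t * Ln z)"
    unfolding powr_def L using z by (simp add: algebra_simps)
  then show ?thesis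
    using z by (simp only: powr_def cis_conv_exp exp_add) simp
qed

text \<open>After interchanging the integrals, the inner one is the functional calculus at w/(e^u +
  w) with w = e^(-i \<theta>) z. This function equals z/(z + a) = 1 - a/(z + a), so the integrals
  for 1 and 1/(z + a) determine it.\<close>

lemma power_truncation_form:
  fixes A :: "complex ^ 'n ^ 'n"
  assumes \<theta>: "\<bar>\<theta>\<bar> \<le> pi / 2"
    and ev: "\<And>p. eigenvalue_mat A p \<Longrightarrow> cmod (p - of_real R) < r" and r: "0 < r" "r < R"
    and x: "norm x = 1"
  defines "f \<equiv> resolvent_form A x x"
    and "a \<equiv> \<lambda>u. exp u * cis \<theta>"
  shows "(\<lambda>u. exp (of_real t * u) * (1 + a u * f (- a u))) contour_integrable_on
      linepath (of_real (- n)) (of_real n)" (is ?int)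
    and "contour_integral (circlepath (of_real R) r) (\<lambda>z. power_truncation t n (cis (- \<theta>) * z) * f z) =
      2 * of_real pi * \<i> * contour_integral (linepath (of_real (- n)) (of_real n))
        (\<lambda>u. exp (of_real t * u) * (1 + a u * f (- a u)))" (is ?eq)
proof -
  let ?C = "circlepath (of_real R) r" and ?l = "linepath (complex_of_real (- n)) (of_real n)"
  let ?w = "\<lambda>z. cis (- \<theta>) * z"
  have Re_pos: "Re z > 0" if "cmod (z - of_real R) \<le> r" for z
    using abs_Re_le_cmod[of "z - of_real R"] that r by simp
  have img: "path_image ?C \<subseteq> resolvent_set A"
    using ev r by (force simp: resolvent_iff_not_eigenvalue dist_norm norm_minus_commute)
  have C_pos: "Re z > 0" if "z \<in> path_image ?C" for z
    using that r Re_pos by (auto simp: dist_norm norm_minus_commute)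
  have w: "?w z \<notin> \<real>\<^sub>\<le>\<^sub>0" if "z \<in> path_image ?C" for z
    by (rule rotated_not_nonpos_Reals[OF C_pos[OF that] \<theta>])
  have l: "u \<in> \<real>" if "u \<in> path_image ?l" for u
    using that linepath_of_real_subset_Reals[of "- n" n] by auto
  \<comment> \<open>The points \<open>- a u\<close> lie in the closed left half-plane, hence outside
    the disc: they belong to the resolvent set, and 1/(z + a u) is holomorphic on the open right
    half-plane containing the circle.\<close>
  have a_neg: "Re (- a u) \<le> 0" if "u \<in> \<real>" for u
  proof -
    have "cos \<theta> \<ge> 0" using \<theta> by (intro cos_ge_zero) auto
    then show ?thesis using that by (auto simp: a_def exp_of_real elim!: Reals_cases)
  qed
  have a_res: "- a u \<in> resolvent_set A" if "u \<in> \<real>" for u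
    using a_neg[OF that] ev Re_pos unfolding resolvent_iff_not_eigenvalue by (meson less_imp_le not_le)
  have f_cont: "continuous_on (resolvent_set A) f"
    unfolding f_def by (intro holomorphic_on_imp_continuous_on resolvent_form_holomorphic)
  have wind: "winding_number ?C p = 1" if "eigenvalue_mat A p" for p
    using ev[OF that] by (intro winding_number_circlepath) auto
  note form = contour_integral_resolvent_form[OF valid_path_circlepath _ img wind]
    and form_divide = contour_integral_resolvent_form_divide[OF valid_path_circlepath _ img wind]
  have "continuous_on (path_image ?l) (\<lambda>u. f (- a u))"
    by (rule continuous_on_compose2[OF f_cont]) (use l a_res in \<open>auto simp: a_def intro!: continuous_intros\<close>)
  then have "continuous_on (path_image ?l) (\<lambda>u. exp (of_real t * u) * (1 + a u * f (- a u)))"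
    unfolding a_def by (intro continuous_intros)
  then show ?int by (intro contour_integrable_continuous_linepath) simp
  define k where "k u z = exp (of_real t * u) * (?w z / (exp u + ?w z)) * f z" for u z
  have inner: "contour_integral ?C (k u) = 2 * of_real pi * \<i> * (exp (of_real t * u) * (1 + a u * f (- a u)))"
    if u: "u \<in> \<real>" for u
  proof -
    let ?y = "- (matrix_inv (mat (- a u) - A) *v x)"
    have "a u *s ?y + A *v ?y = x"
      using resolvent_mult(1)[OF a_res[OF u], of x]
      by (simp add: matrix_vector_mult_diff_rdistrib mat_mult_vec linear_neg)
    moreover have "((\<lambda>z. 1 / (z + a u)) has_contour_integral 0) ?C"
    proof (rule Cauchy_theorem_convex_simple[of _ "{z. Re z > 0}"])
      show "(\<lambda>z. 1 / (z + a u)) holomorphic_on {z. Re z > 0}"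
        using a_neg[OF u] by (intro holomorphic_intros) (auto simp: add_eq_0_iff2)
    qed (use C_pos convex_halfspace_Re_gt[of 0] in auto)
    moreover have "- a u \<notin> path_image ?C" using C_pos a_neg[OF u] by force
    ultimately have "((\<lambda>z. f z / (z + a u)) has_contour_integral 2 * of_real pi * \<i> * cinner ?y x) ?C"
      unfolding f_def by (intro form_divide) auto
    moreover have "cinner ?y x = - f (- a u)"
      by (simp add: f_def resolvent_form_def cinner_def sum_negf)
    moreover have "(f has_contour_integral 2 * of_real pi * \<i>) ?C"
      using resolvent_form_has_contour_integral[OF _ img, of x x] form[of x x] x
      by (simp add: f_def cinner_self)
    ultimately have "((\<lambda>z. exp (of_real t * u) * (f z - a u * (f z / (z + a u)))) has_contour_integral
        exp (of_real t * u) * (2 * of_real pi * \<i> - a u * (2 * of_real pi * \<i> * (- f (- a u))))) ?C"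
      by (intro has_contour_integral_lmul has_contour_integral_diff) auto
    then have "(k u has_contour_integral
        exp (of_real t * u) * (2 * of_real pi * \<i> - a u * (2 * of_real pi * \<i> * (- f (- a u))))) ?C"
    proof (rule has_contour_integral_eq)
      fix z assume z: "z \<in> path_image ?C"
      have "exp u + ?w z \<noteq> 0" using exp_of_real_plus_nonzero[OF w[OF z] u] .
      moreover have za: "z + a u = cis \<theta> * (exp u + ?w z)"
        by (simp add: a_def algebra_simps cis_mult flip: mult.assoc)
      ultimately have "z + a u \<noteq> 0" by simp
      then have "f z - a u * (f z / (z + a u)) = z / (z + a u) * f z"
        by (simp add: field_simps)
      also have "z / (z + a u) = ?w z / (exp u + ?w z)"
      proof -
        have "z / (z + a u) = (cis \<theta> * ?w z) / (z + a u)" by (simp add: cis_mult flip: mult.assoc)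
        then show ?thesis unfolding za by simp
      qed
      finally show "exp (of_real t * u) * (f z - a u * (f z / (z + a u))) = k u z"
        by (simp add: k_def)
    qed
    then show ?thesis by (simp add: contour_integral_unique algebra_simps)
  qed
  have "contour_integral ?C (\<lambda>z. power_truncation t n (?w z) * f z) =
      contour_integral ?C (\<lambda>z. contour_integral ?l (\<lambda>u. k u z))"
    unfolding k_def power_truncation_def
    by (intro contour_integral_cong contour_integral_rmul[symmetric] power_truncation_integrable w) auto
  \<comment> \<open>Fubini for a jointly continuous integrand; its denominator has no zero on the
    product of the two path images.\<close>
  also have "\<dots> = contour_integral ?l (\<lambda>u. contour_integral ?C (k u))"
  proof (rule contour_integral_swap[symmetric])
    have "continuous_on (path_image ?l \<times> path_image ?C) (\<lambda>p. f (snd p))"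
      by (rule continuous_on_compose2[OF f_cont]) (use img in \<open>auto intro!: continuous_intros\<close>)
    then show "continuous_on (path_image ?l \<times> path_image ?C) (\<lambda>(u, z). k u z)"
      unfolding k_def case_prod_beta
      using exp_of_real_plus_nonzero[OF w l] by (intro continuous_intros) auto
    show "continuous_on {0..1} (\<lambda>t. vector_derivative ?l (at t))"
      by (auto intro!: continuous_intros)
    show "continuous_on {0..1} (\<lambda>t. vector_derivative ?C (at t))"
      by (auto simp: vector_derivative_circlepath intro!: continuous_intros)
  qed auto
  also have "\<dots> = contour_integral ?l
      (\<lambda>u. 2 * of_real pi * \<i> * (exp (of_real t * u) * (1 + a u * f (- a u))))"
    by (rule contour_integral_cong) (use inner l in auto)
  also have "\<dots> = 2 * of_real pi * \<i> * contour_integral ?l (\<lambda>u. exp (of_real t * u) * (1 + a u * f (- a u)))"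
    by (rule contour_integral_lmul[OF \<open>?int\<close>])
  finally show ?eq .
qed

lemma Re_of_real_mult: "Re (of_real r * z) = r * Re z"
  by simp

lemma continuous_on_powr_slit_plane: "continuous_on (- \<real>\<^sub>\<le>\<^sub>0) (\<lambda>z::complex. z powr c)"
  by (intro holomorphic_on_imp_continuous_on holomorphic_intros) auto

text \<open>The bound of \<open>Re_resolvent_form_ge\<close>, weighted by e^(tu) and integrated,
  compares the truncation at \<omega> with the Cauchy integral \<open>J\<close> of the truncated
  power. Both are \<open>C n\<close> times the corresponding true power, up to multiples of
  \<open>E n\<close>. As \<open>E n\<close> tends to 0 while \<open>C n\<close> is at least
  \<open>c\<close>, no positive deficit \<open>D\<close> can persist.\<close>

lemma Re_power_form_ge:
  fixes A :: "complex ^ 'n ^ 'n"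
  assumes t: "0 < t" "t < 1" and \<theta>: "\<bar>\<theta>\<bar> \<le> pi / 2"
    and ev: "\<And>p. eigenvalue_mat A p \<Longrightarrow> cmod (p - of_real R) < r" and r: "0 < r" "r < R"
    and form: "\<And>v. Re (cis (- \<theta>) * cinner (A *v v) v) \<ge> 0"
      "\<And>v. Re (cis (- \<theta>) * cinner (A *v v) v) \<le> \<omega> * (norm v)\<^sup>2"
    and x: "norm x = 1" "Re (cis (- \<theta>) * cinner (A *v x) x) = \<omega>" and \<omega>: "\<omega> > 0"
  shows "\<omega> powr t \<le> Re (1 / (2 * of_real pi * \<i>) * contour_integral (circlepath (of_real R) r)
    (\<lambda>z. (cis (- \<theta>) * z) powr of_real t * resolvent_form A x x z))"
    (is "_ \<le> Re ?P")
proof (rule ccontr)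
  assume neg: "\<not> ?thesis"
  define D where "D = \<omega> powr t - Re ?P"
  have D: "D > 0" using neg by (simp add: D_def)
  let ?C = "circlepath (of_real R) r"
  let ?w = "\<lambda>z. cis (- \<theta>) * z"
  define f where "f = resolvent_form A x x"
  have img: "path_image ?C \<subseteq> resolvent_set A"
    using ev r by (force simp: resolvent_iff_not_eigenvalue dist_norm norm_minus_commute)
  have C_pos: "Re z > 0" if "z \<in> path_image ?C" for z
    using that r abs_Re_le_cmod[of "z - of_real R"] by (auto simp: dist_norm norm_minus_commute)
  have w: "?w z \<notin> \<real>\<^sub>\<le>\<^sub>0" if "z \<in> path_image ?C" for z
    by (rule rotated_not_nonpos_Reals[OF C_pos[OF that] \<theta>])
  have f_cont: "continuous_on (path_image ?C) f"
    unfolding f_def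
    by (intro holomorphic_on_imp_continuous_on holomorphic_on_subset[OF resolvent_form_holomorphic img])
  have cpt: "compact (path_image ?C)" by (intro compact_path_image) auto
  obtain K where K: "K > 0" "\<And>z. z \<in> path_image ?C \<Longrightarrow> cmod (f z) \<le> K"
    using compact_imp_bounded[OF compact_continuous_image[OF f_cont cpt]]
    unfolding bounded_pos by auto
  have "continuous_on (path_image ?C) (\<lambda>z. Ln (?w z))"
    using w by (intro continuous_intros) auto
  from compact_imp_bounded[OF compact_continuous_image[OF this cpt]]
  obtain M0 where M0: "\<And>z. z \<in> path_image ?C \<Longrightarrow> cmod (Ln (?w z)) \<le> M0"
    unfolding bounded_iff by blast
  \<comment> \<open>One bound for \<open>Ln\<close> both on the rotated circle and at \<omega>, so
    that a single error \<open>E n\<close> serves both sides.\<close>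
  define M where "M = max 0 (max M0 (cmod (Ln (of_real \<omega>))))"
  obtain C c where C: "c > 0" "\<And>n. n \<ge> 1 \<Longrightarrow> power_truncation t n 1 = of_real (C n) \<and> C n \<ge> c"
    using power_truncation_one[of t] by blast
  define E where "E n = exp M * (4 * M * exp (- min t (1 - t) * (n - M)))" for n
  have E_nonneg: "E n \<ge> 0" for n by (simp add: E_def M_def)
  have int1: "(\<lambda>z. ?w z powr of_real t * f z) contour_integrable_on ?C"
  proof (intro contour_integrable_continuous_circlepath continuous_on_mult f_cont)
    show "continuous_on (path_image ?C) (\<lambda>z. ?w z powr of_real t)"
      by (rule continuous_on_compose2[OF continuous_on_powr_slit_plane])
        (use w in \<open>auto intro!: continuous_intros\<close>)
  qed
  \<comment> \<open>The summand 1 is the error at \<omega>; \<open>K * r\<close> comes from the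
    Cauchy integral, with length 2 pi r divided by 2 pi.\<close>
  have main: "D * c \<le> E n * (1 + K * r)" if n: "n \<ge> M + 1" for n
  proof -
    have n1: "n \<ge> 1" "n > 0" using n by (auto simp: M_def)
    let ?l = "linepath (complex_of_real (- n)) (of_real n)"
    let ?G = "power_truncation t n"
    define J where "J = 1 / (2 * of_real pi * \<i>) * contour_integral ?C (\<lambda>z. ?G (?w z) * f z)"
    let ?h = "\<lambda>u. exp (of_real t * u) * (1 + exp u * cis \<theta> * f (- (exp u * cis \<theta>)))"
    have h_int: "?h contour_integrable_on ?l"
      unfolding f_def by (rule power_truncation_form(1)[OF \<theta> _ r x(1)]) (rule ev)
    have J: "J = contour_integral ?l ?h"
      unfolding J_def f_def by (subst power_truncation_form(2)[OF \<theta> _ r x(1)]) (use ev in auto)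
    \<comment> \<open>With s = e^u, \<omega>/(s + \<omega>) is the integrand of the truncation at
      \<omega> without its positive weight e^(tu).\<close>
    have "Re (?G (of_real \<omega>)) \<le> Re J"
      unfolding J power_truncation_def of_real_minus[symmetric]
    proof (rule Re_contour_integral_linepath_mono[OF _ power_truncation_integrable h_int])
      fix u :: real
      let ?a = "of_real (exp u) * cis \<theta>"
      have "- ?a \<in> resolvent_set A"
      proof -
        have "cos \<theta> \<ge> 0" using \<theta> by (intro cos_ge_zero) auto
        then have "Re (- ?a) \<le> 0" by simp
        then have "\<not> cmod (- ?a - of_real R) < r"
          using abs_Re_le_cmod[of "- ?a - of_real R"] r by auto
        then show ?thesis using ev resolvent_iff_not_eigenvalue by blast
      qed
      from Re_resolvent_form_ge[OF form x exp_gt_zero refl this]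
      have "exp (t * u) * (\<omega> / (exp u + \<omega>)) \<le> exp (t * u) * Re (1 + ?a * f (- ?a))"
        unfolding f_def by (intro mult_left_mono) auto
      also have "\<dots> = Re (?h (of_real u))"
      proof -
        have "exp (of_real t * of_real u) = complex_of_real (exp (t * u))"
          "exp (of_real u) = complex_of_real (exp u)"
          by (simp_all flip: exp_of_real)
        then show ?thesis by (simp only: Re_of_real_mult)
      qed
      also have "exp (t * u) * (\<omega> / (exp u + \<omega>)) = Re (exp (of_real t * of_real u) * (of_real \<omega> / (exp (of_real u) + of_real \<omega>)))"
        by (simp only: of_real_mult[symmetric] exp_of_real of_real_add[symmetric]
            of_real_divide[symmetric] Re_complex_of_real)
      finally show "Re (exp (of_real t * of_real u) * (of_real \<omega> / (exp (of_real u) + of_real \<omega>))) \<le> Re (?h (of_real u))" .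
    qed (use n1 \<omega> in \<open>auto simp: complex_nonpos_Reals_iff\<close>)
    moreover have "Re (?G (of_real \<omega>)) \<ge> \<omega> powr t * C n - E n"
    proof -
      have "cmod (?G (of_real \<omega>) - of_real \<omega> powr of_real t * ?G 1) \<le> E n"
        unfolding E_def using n \<omega>
        by (intro power_truncation_approx t) (auto simp: complex_nonpos_Reals_iff M_def)
      moreover have "of_real \<omega> powr of_real t * ?G 1 = of_real (\<omega> powr t * C n)"
        using C(2)[OF n1(1)] \<omega> by (simp add: powr_of_real)
      ultimately show ?thesis
        using abs_Re_le_cmod[of "?G (of_real \<omega>) - of_real (\<omega> powr t * C n)"] by simp
    qed
    moreover have "Re J \<le> C n * Re ?P + E n * K * r"
    proof -
      have int2: "(\<lambda>z. ?G (?w z) * f z) contour_integrable_on ?C"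
      proof (intro contour_integrable_continuous_circlepath continuous_intros f_cont)
        show "continuous_on (path_image ?C) (\<lambda>z. ?G (?w z))"
          by (rule continuous_on_compose2[OF holomorphic_on_imp_continuous_on[OF power_truncation_holomorphic]])
            (use w in \<open>auto intro!: continuous_intros\<close>)
      qed
      have "((\<lambda>z. ?G (?w z) * f z - of_real (C n) * (?w z powr of_real t * f z)) has_contour_integral
          (contour_integral ?C (\<lambda>z. ?G (?w z) * f z)
            - of_real (C n) * contour_integral ?C (\<lambda>z. ?w z powr of_real t * f z))) ?C" (is "(_ has_contour_integral ?I) _")
        by (intro has_contour_integral_diff has_contour_integral_lmul has_contour_integral_integral int1 int2)
      then have "cmod ?I \<le> E n * K * (2 * pi * r)"
      proof (rule has_contour_integral_bound_circlepath)
        fix z assume "cmod (z - of_real R) = r"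
        then have z: "z \<in> path_image ?C" using r by (simp add: dist_norm norm_minus_commute)
        have "cmod (Ln (?w z)) \<le> M" using M0[OF z] by (simp add: M_def)
        from power_truncation_approx[OF t w[OF z] this n]
        have "cmod (?G (?w z) - ?w z powr of_real t * of_real (C n)) \<le> E n"
          using C(2)[OF n1(1)] by (simp add: E_def)
        then have "cmod ((?G (?w z) - ?w z powr of_real t * of_real (C n)) * f z) \<le> E n * K"
          unfolding norm_mult using K(2)[OF z] E_nonneg by (intro mult_mono) auto
        then show "cmod (?G (?w z) * f z - of_real (C n) * (?w z powr of_real t * f z)) \<le> E n * K"
          by (simp add: algebra_simps)
      qed (use K r E_nonneg in auto)
      moreover have "J - of_real (C n) * ?P = 1 / (2 * of_real pi * \<i>) * ?I"
        by (simp add: J_def f_def field_simps)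
      then have "cmod (J - of_real (C n) * ?P) = cmod ?I / (2 * pi)"
        by (simp only: norm_mult norm_divide) simp
      ultimately have "cmod (J - of_real (C n) * ?P) \<le> E n * K * (2 * pi * r) / (2 * pi)"
        by (simp only:) (intro divide_right_mono; simp)
      also have "\<dots> = E n * K * r" by simp
      finally have "Re (J - of_real (C n) * ?P) \<le> E n * K * r"
        by (rule order_trans[OF complex_Re_le_cmod])
      moreover have "Re (of_real (C n) * ?P) = C n * Re ?P" by (rule Re_of_real_mult)
      ultimately show ?thesis by simp
    qed
    ultimately have "D * C n \<le> E n * (1 + K * r)"
      unfolding D_def by (simp only: algebra_simps) 
    moreover have "D * c \<le> D * C n" using C(2)[OF n1(1)] D by (intro mult_left_mono) auto
    ultimately show ?thesis by simp
  qed
  define m where "m = min t (1 - t)"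
  have "m > 0" using t by (simp add: m_def)
  then have "((\<lambda>n. exp M * (4 * M * exp (- m * (n - M))) * (1 + K * r)) \<longlongrightarrow> 0) at_top"
    by real_asymp
  then have "((\<lambda>n. E n * (1 + K * r)) \<longlongrightarrow> 0) at_top" by (simp add: E_def m_def)
  then have "D * c \<le> 0"
    by (rule tendsto_lowerbound) (use main in \<open>auto intro: eventually_mono[OF eventually_ge_at_top[of "M + 1"]]\<close>)
  then show False using D C(1) by (simp add: mult_le_0_iff)
qed

section \<open>The power as a Cauchy integral over any admissible contour\<close>

text \<open>The contour inside \<open>mat_powr\<close> is an unspecified choice. The entrywise
  integrals combine linearly into one scalar integral, which the residue theorem moves to
  \<open>g\<close>; contours in the simply connected slit plane do not wind around points outside
  it.\<close>

lemma cinner_mat_powr: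
  fixes A :: "complex ^ 'n ^ 'n"
  assumes A: "accretive_dissipative A"
    and g: "valid_path g" "pathfinish g = pathstart g" "path_image g \<subseteq> resolvent_set A"
      "path_image g \<inter> \<real>\<^sub>\<le>\<^sub>0 = {}" "\<And>p. eigenvalue_mat A p \<Longrightarrow> winding_number g p = 1"
  shows "cinner (mat_powr A t *v x) y = 1 / (2 * of_real pi * \<i>) *
    contour_integral g (\<lambda>z. z powr of_real t * resolvent_form A x y z)"
proof -
  define S where "S = - (\<real>\<^sub>\<le>\<^sub>0 :: complex set)"
  have S: "open S" "connected S" "simply_connected S"
  proof -
    have eq: "S = - (complex_of_real ` {..0})" by (auto simp: S_def nonpos_Reals_def)
    show "open S" unfolding S_def by (simp add: open_Compl)
    show "simply_connected S"
      unfolding eq by (intro starlike_imp_simply_connected starlike_slotted_complex_plane_left)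
    then show "connected S" by (rule simply_connected_imp_connected)
  qed
  define h where "h = (SOME \<gamma>. power_contour A \<gamma>)"
  have "power_contour A h"
    unfolding h_def by (rule someI_ex[OF power_contour_exists[OF A]])
  then have h: "valid_path h" "pathfinish h = pathstart h" "path_image h \<subseteq> resolvent_set A"
      "path_image h \<inter> \<real>\<^sub>\<le>\<^sub>0 = {}" "\<And>p. eigenvalue_mat A p \<Longrightarrow> winding_number h p = 1"
    by (auto simp: power_contour_def)
  let ?F = "\<lambda>z. z powr of_real t * resolvent_form A x y z"
  let ?R = "\<lambda>i j z. z powr of_real t * matrix_inv (mat z - A) $ i $ j"
  have powr: "(\<lambda>z. z powr of_real t) holomorphic_on S \<inter> resolvent_set A"
    by (intro holomorphic_intros) (auto simp: S_def)
  have entry: "?R i j holomorphic_on S \<inter> resolvent_set A" for i j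
  proof (intro holomorphic_on_mult powr)
    \<comment> \<open>Applying the resolvent to a basis vector identifies its entries with
      components already known to be holomorphic.\<close>
    have "(matrix_inv (mat z - A) *v axis j 1) $ i = matrix_inv (mat z - A) $ i $ j" for z
      by (simp add: matrix_vector_mult_def axis_def if_distrib[of "\<lambda>y. _ * y"] cong: if_cong)
    then show "(\<lambda>z. matrix_inv (mat z - A) $ i $ j) holomorphic_on S \<inter> resolvent_set A"
      using holomorphic_on_subset[OF resolvent_vector_holomorphic[of A "axis j 1" i]] by simp
  qed
  have op: "open (S \<inter> resolvent_set A)" by (intro open_Int S open_resolvent_set)
  have him: "path_image h \<subseteq> S \<inter> resolvent_set A" using h(3,4) by (auto simp: S_def)
  have int: "?R i j contour_integrable_on h" for i j
    by (rule contour_integrable_holomorphic_simple[OF entry op h(1) him])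
  have "cinner (mat_powr A t *v x) y =
      1 / (2 * of_real pi * \<i>) * (\<Sum>i\<in>UNIV. \<Sum>j\<in>UNIV. contour_integral h (?R i j) * (x $ j * cnj (y $ i)))"
    by (simp add: cinner_def matrix_vector_mult_def mat_powr_def Let_def h_def[symmetric]
        sum_distrib_left sum_distrib_right mult.assoc)
  also have "(\<Sum>i\<in>UNIV. \<Sum>j\<in>UNIV. contour_integral h (?R i j) * (x $ j * cnj (y $ i))) =
      contour_integral h (\<lambda>z. \<Sum>i\<in>UNIV. \<Sum>j\<in>UNIV. ?R i j z * (x $ j * cnj (y $ i)))"
    by (intro contour_integral_unique[symmetric] has_contour_integral_sum finite
        has_contour_integral_rmul has_contour_integral_integral int)
  also have "(\<lambda>z. \<Sum>i\<in>UNIV. \<Sum>j\<in>UNIV. ?R i j z * (x $ j * cnj (y $ i))) = ?F"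
    by (simp add: resolvent_form_def cinner_def matrix_vector_mult_def sum_distrib_left
        sum_distrib_right mult.assoc)
  also have "contour_integral h ?F = contour_integral g ?F"
  proof (rule contour_integral_eq_if_winding_number_eq[OF S(1,2) finite_eigenvalues])
    show "?F holomorphic_on S - {z. eigenvalue_mat A z}"
      using holomorphic_on_mult[OF powr holomorphic_on_subset[OF resolvent_form_holomorphic[of A x y]]]
      by (simp add: resolvent_set_eq Diff_eq)
    show "winding_number h z = 0" if "z \<notin> S" for z
      using h that him by (intro simply_connected_imp_winding_number_zero[OF S(3)]) (auto simp: valid_path_imp_path)
    show "winding_number g z = 0" if "z \<notin> S" for z
      using g that by (intro simply_connected_imp_winding_number_zero[OF S(3)]) (auto simp: valid_path_imp_path S_def)
  qed (use g h him in \<open>auto simp: S_def resolvent_set_eq\<close>)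
  finally show ?thesis .
qed

section \<open>Choice of the circle and conclusion\<close>

text \<open>|p - R| < R means |p|^2 < 2 R Re p, so any R > 0 that dominates every |p|^2 / Re p
  works. As r < R, the circle stays in the open right half-plane, and a rotation by at most pi/2
  keeps it in the slit plane.\<close>

lemma enclosing_disc_right_half_plane:
  assumes P: "finite P" "\<And>p. p \<in> P \<Longrightarrow> Re p > 0"
  obtains R r where "0 < r" "r < R" "\<And>p. p \<in> P \<Longrightarrow> cmod (p - of_real R) < r"
proof -
  let ?q = "\<lambda>p. (cmod p)\<^sup>2 / Re p"
  define R where "R = 1 + sum ?q P"
  have q: "?q p \<ge> 0" if "p \<in> P" for p using P(2)[OF that] by simp
  have R: "R > 0" unfolding R_def using sum_nonneg[of P ?q] q by (simp add: add_pos_nonneg)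
  have less: "cmod (p - of_real R) < R" if p: "p \<in> P" for p
  proof -
    have "?q p \<le> R" unfolding R_def using member_le_sum[OF p, of ?q] q P(1) by fastforce
    then have "(cmod p)\<^sup>2 \<le> R * Re p" using P(2)[OF p] by (simp add: field_simps)
    also have "\<dots> < 2 * R * Re p" using P(2)[OF p] R by simp
    finally have "(cmod (p - of_real R))\<^sup>2 < R\<^sup>2"
      unfolding cmod_power2 by (simp add: power2_eq_square algebra_simps)
    then show ?thesis using R by (rule power2_less_imp_less[OF _ less_imp_le])
  qed
  \<comment> \<open>The inserted \<open>0\<close> makes \<open>r\<close> positive and keeps
    \<open>Max\<close> meaningful for empty \<open>P\<close>.\<close>
  have "Max (insert 0 ((\<lambda>p. cmod (p - of_real R)) ` P)) < R"
    using P(1) R less by simp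
  then obtain r where r: "Max (insert 0 ((\<lambda>p. cmod (p - of_real R)) ` P)) < r" "r < R"
    using dense by blast
  then show ?thesis using P(1) by (intro that[of r R]) auto
qed

theorem theorem3p5:
  fixes A :: "complex ^ 'n ^ 'n" and t :: real
  assumes "accretive_dissipative A"
    and "t \<in> {0<..<1}"
  shows "numerical_radius (mat_powr A t) \<ge> numerical_radius A powr t"
proof -
  let ?\<omega> = "numerical_radius A"
  have pos: "Re w > 0" "Im w > 0" if "w \<in> numerical_range A" for w
    using numerical_range_accretive_dissipative[OF assms(1) that] by auto
  obtain w where w: "w \<in> numerical_range A" "cmod w = ?\<omega>"
    using numerical_radius_attained[of A] by blast
  obtain x where x: "w = cinner (A *v x) x" "norm x = 1"
    using w(1) by (auto simp: numerical_range_def)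
  define \<theta> where "\<theta> = Arg w"
  have w0: "w \<noteq> 0" using pos[OF w(1)] by auto
  have \<theta>: "\<bar>\<theta>\<bar> < pi / 2" "0 < \<theta>"
    using pos[OF w(1)] Arg_Re_pos[of w] Arg_pos_iff[of w] unfolding \<theta>_def by blast+
  have w_eq: "w = of_real ?\<omega> * cis \<theta>"
    using w(2) by (metis \<theta>_def rcis_cmod_Arg rcis_def)
  have \<omega>: "?\<omega> > 0" using w0 unfolding w(2)[symmetric] by simp
  have form_ge: "Re (cis (- \<theta>) * cinner (A *v v) v) \<ge> 0" for v
  proof -
    obtain u where u: "u \<in> numerical_range A" "cinner (A *v v) v = u * complex_of_real ((norm v)\<^sup>2)"
      by (rule cinner_eq_numerical_range)
    \<comment> \<open>The real part of \<open>cis (- \<theta>) * u\<close> is cos \<theta> Re u +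
      sin \<theta> Im u, a sum of nonnegative products since both \<open>u\<close> and
      \<open>cis \<theta>\<close> lie in the first quadrant.\<close>
    have "cos \<theta> \<ge> 0" "sin \<theta> \<ge> 0"
      using \<theta> by (auto intro!: cos_ge_zero sin_ge_zero)
    then have "Re (cis (- \<theta>) * u) \<ge> 0" using pos[OF u(1)] by simp
    then have "Re (cis (- \<theta>) * u) * (norm v)\<^sup>2 \<ge> 0" by simp
    also have "Re (cis (- \<theta>) * u) * (norm v)\<^sup>2 = Re (cis (- \<theta>) * cinner (A *v v) v)"
      unfolding u(2) by (simp add: algebra_simps)
    finally show ?thesis .
  qed
  have form_le: "Re (cis (- \<theta>) * cinner (A *v v) v) \<le> ?\<omega> * (norm v)\<^sup>2" for v
  proof -
    have "Re (cis (- \<theta>) * cinner (A *v v) v) \<le> cmod (cis (- \<theta>) * cinner (A *v v) v)"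
      by (rule complex_Re_le_cmod)
    also have "\<dots> \<le> ?\<omega> * (norm v)\<^sup>2"
      using norm_cinner_le_numerical_radius[of A v] by (simp add: norm_mult)
    finally show ?thesis .
  qed
  have form_eq: "Re (cis (- \<theta>) * cinner (A *v x) x) = ?\<omega>"
  proof -
    have "cis (- \<theta>) * w = of_real ?\<omega> * (cis (- \<theta>) * cis \<theta>)"
      by (subst w_eq) (rule mult.left_commute)
    then show ?thesis unfolding x(1)[symmetric] by (simp add: cis_mult)
  qed
  obtain R r where R: "0 < r" "r < R" "\<And>p. eigenvalue_mat A p \<Longrightarrow> cmod (p - of_real R) < r"
    using enclosing_disc_right_half_plane[OF finite_eigenvalues[of A]] pos(1)[OF eigenvalue_in_numerical_range]
    by (metis mem_Collect_eq)
  let ?C = "circlepath (of_real R) r"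
  have C_pos: "Re z > 0" if "z \<in> path_image ?C" for z
    using that R(1,2) abs_Re_le_cmod[of "z - of_real R"] by (auto simp: dist_norm norm_minus_commute)
  have C_res: "path_image ?C \<subseteq> resolvent_set A"
    using R by (force simp: resolvent_iff_not_eigenvalue dist_norm norm_minus_commute)
  have C_slit: "path_image ?C \<inter> \<real>\<^sub>\<le>\<^sub>0 = {}"
    using C_pos by (fastforce simp: complex_nonpos_Reals_iff simp del: path_image_circlepath)
  have P: "cinner (mat_powr A t *v x) x = 1 / (2 * of_real pi * \<i>) *
      contour_integral ?C (\<lambda>z. z powr of_real t * resolvent_form A x x z)" (is "_ = _ * contour_integral _ ?F")
  proof (rule cinner_mat_powr[OF assms(1)])
    show "path_image ?C \<subseteq> resolvent_set A" by (rule C_res)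
    show "path_image ?C \<inter> \<real>\<^sub>\<le>\<^sub>0 = {}" by (rule C_slit)
    show "winding_number ?C p = 1" if "eigenvalue_mat A p" for p
      using R(3)[OF that] by (intro winding_number_circlepath) auto
  qed auto
  have "?\<omega> powr t \<le> Re (1 / (2 * of_real pi * \<i>) * contour_integral ?C
      (\<lambda>z. (cis (- \<theta>) * z) powr of_real t * resolvent_form A x x z))"
    by (rule Re_power_form_ge) (use assms(2) \<theta> R form_ge form_le form_eq x(2) \<omega> in auto)
  \<comment> \<open>On the circle the rotation comes out of the power as one constant factor of
    modulus 1, which disappears on taking the modulus at the end.\<close>
  also have "contour_integral ?C (\<lambda>z. (cis (- \<theta>) * z) powr of_real t * resolvent_form A x x z)
      = contour_integral ?C (\<lambda>z. cis (- (t * \<theta>)) * ?F z)"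
    using C_pos \<theta> by (intro contour_integral_cong) (auto simp: powr_rotated)
  also have "\<dots> = cis (- (t * \<theta>)) * contour_integral ?C ?F"
  proof (rule contour_integral_lmul)
    have "continuous_on (path_image ?C) (resolvent_form A x x)"
      using C_res by (intro holomorphic_on_imp_continuous_on holomorphic_on_subset[OF resolvent_form_holomorphic])
    then show "?F contour_integrable_on ?C"
      using C_slit
      by (intro contour_integrable_continuous_circlepath continuous_on_mult
          continuous_on_subset[OF continuous_on_powr_slit_plane]) auto
  qed
  also have "1 / (2 * of_real pi * \<i>) * \<dots> = cis (- (t * \<theta>)) * cinner (mat_powr A t *v x) x"
    unfolding P by simp
  also have "Re \<dots> \<le> cmod \<dots>" by (rule complex_Re_le_cmod)
  also have "\<dots> = cmod (cinner (mat_powr A t *v x) x)" by (simp add: norm_mult)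
  also have "\<dots> \<le> numerical_radius (mat_powr A t)"
    using norm_cinner_le_numerical_radius[of "mat_powr A t" x] x(2) by simp
  finally show ?thesis .
qed

end
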